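(* Let $A=I-N\in\mathbb R^{n\times n}$, $n\ge 2$, $N\ge 0$, be a singular M-matrix such that $N\boldsymbol u=\boldsymbol u$ for a given vector $\boldsymbol u>0$; moreover, assume that $1$ is a simple eigenvalue of $N$. Let $X_0\in\mathbb R^{n\times n}$ satisfy $X_0\ge 0$ and $X_0\boldsymbol u\le\boldsymbol u$, and let $$X_{k+1}=\tfrac12\,(X_k^2+N),\quad k=0,1,2,\ldots.$$ Then the sequence $\{X_k\}_k$ converges to the minimal nonnegative solution $G$ of the matrix equation $X^2-2X+N=0$. Moreover, let $\lambda_1,\ldots,\lambda_n$ be the eigenvalues of $G$ (counted with algebraic multiplicity), ordered so that $1=\lambda_1>|\lambda_2|\ge\cdots\ge|\lambda_n|$. If $X_0\boldsymbol u=\boldsymbol u$, then $$\limsup_{k\to\infty}\|X_k-G\|^{1/k}\le\sigma,\qquad \sigma=\frac12\max_{2\le i\le n}\ \max_{1\le j\le n}|\lambda_i+\lambda_j|<1.$$ If, in addition to $X_0\boldsymbol u=\boldsymbol u$, one has $\boldsymbol v^\top X_0=\boldsymbol v^\top$, where $\boldsymbol v>0$ is such that $\boldsymbol v^\top N=\boldsymbol v^\top$, then the bound $\limsup_{k\to\infty}\|X_k-G\|^{1/k}\le\sigma$ holds with $\sigma=|\lambda_2|$.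
   Context: All inequalities between real matrices or vectors are entry-wise; $\rho(\cdot)$ denotes the spectral radius. An M-matrix is a real square matrix of the form $\alpha I-B$ with $B\ge 0$, $\alpha>0$ and $\rho(B)\le\alpha$. A minimal nonnegative solution of a matrix equation is a solution $G\ge 0$ such that $G\le Y$ for every solution $Y\ge 0$ of the same equation; for the equation $X^2-2X+N=0$ with $N$ as in the claim such a solution exists. An eigenvalue is simple if it has algebraic multiplicity $1$. $\|\cdot\|$ denotes any matrix norm. *)

theory Defs
  imports "Jordan_Normal_Form.Spectral_Radius" "HOL-Library.Extended_Real"
begin

(* Matrices and vectors carry their dimensions explicitly, so "<=" on them is the
   library's entry-wise order.  Its strict part "<" is not entry-wise, hence pos_vec. *)

definition nonneg_mat :: "nat \<Rightarrow> real mat \<Rightarrow> bool" where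
  "nonneg_mat n A \<longleftrightarrow> A \<in> carrier_mat n n \<and> 0\<^sub>m n n \<le> A"

definition pos_vec :: "nat \<Rightarrow> real vec \<Rightarrow> bool" where
  "pos_vec n v \<longleftrightarrow> v \<in> carrier_vec n \<and> (\<forall>i<n. 0 < v $ i)"

definition M_matrix :: "nat \<Rightarrow> real mat \<Rightarrow> bool" where
  "M_matrix n A \<longleftrightarrow> (\<exists>\<alpha> B. 0 < \<alpha> \<and> nonneg_mat n B
     \<and> spectral_radius (map_mat complex_of_real B) \<le> \<alpha>
     \<and> A = \<alpha> \<cdot>\<^sub>m 1\<^sub>m n - B)"

definition simple_eigenvalue :: "real mat \<Rightarrow> real \<Rightarrow> bool" where
  "simple_eigenvalue A x \<longleftrightarrow> eigenvalue A x \<and> order x (char_poly A) = 1"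

definition quad_solution :: "nat \<Rightarrow> real mat \<Rightarrow> real mat \<Rightarrow> bool" where
  "quad_solution n N Y \<longleftrightarrow> Y \<in> carrier_mat n n
     \<and> Y ^\<^sub>m 2 - 2 \<cdot>\<^sub>m Y + N = 0\<^sub>m n n"

definition minimal_nonneg_solution :: "nat \<Rightarrow> real mat \<Rightarrow> real mat \<Rightarrow> bool" where
  "minimal_nonneg_solution n N G \<longleftrightarrow> quad_solution n N G \<and> nonneg_mat n G
     \<and> (\<forall>Y. quad_solution n N Y \<longrightarrow> nonneg_mat n Y \<longrightarrow> G \<le> Y)"

definition mat_tendsto :: "nat \<Rightarrow> (nat \<Rightarrow> real mat) \<Rightarrow> real mat \<Rightarrow> bool" where
  "mat_tendsto n X L \<longleftrightarrow>
     (\<forall>i<n. \<forall>j<n. (\<lambda>k. X k $$ (i, j)) \<longlonglongrightarrow> L $$ (i, j))"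

(* The value of a norm outside carrier_mat n n is irrelevant.  Submultiplicativity is not
   required, so every norm that is called a matrix norm under either convention is covered. *)
definition matrix_norm :: "nat \<Rightarrow> (real mat \<Rightarrow> real) \<Rightarrow> bool" where
  "matrix_norm n \<nu> \<longleftrightarrow>
     (\<forall>A\<in>carrier_mat n n. 0 \<le> \<nu> A \<and> (\<nu> A = 0 \<longleftrightarrow> A = 0\<^sub>m n n)) \<and>
     (\<forall>c. \<forall>A\<in>carrier_mat n n. \<nu> (c \<cdot>\<^sub>m A) = \<bar>c\<bar> * \<nu> A) \<and>
     (\<forall>A\<in>carrier_mat n n. \<forall>B\<in>carrier_mat n n. \<nu> (A + B) \<le> \<nu> A + \<nu> B)"

(* lam 1, ..., lam n are all complex eigenvalues with algebraic multiplicity, and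
   1 = lam 1 > |lam 2| >= ... >= |lam n|; other values of lam are irrelevant. *)
definition ordered_eigenvalues :: "nat \<Rightarrow> real mat \<Rightarrow> (nat \<Rightarrow> complex) \<Rightarrow> bool" where
  "ordered_eigenvalues n G lam \<longleftrightarrow>
     char_poly (map_mat complex_of_real G) = (\<Prod>i=1..n. [:- lam i, 1:]) \<and>
     lam 1 = 1 \<and> cmod (lam 2) < 1 \<and>
     (\<forall>i\<in>{2..<n}. cmod (lam (Suc i)) \<le> cmod (lam i))"

definition sigma :: "nat \<Rightarrow> (nat \<Rightarrow> complex) \<Rightarrow> real" where
  "sigma n lam = 1/2 * (MAX i\<in>{2..n}. MAX j\<in>{1..n}. cmod (lam i + lam j))"

definition root_rate_le :: "nat \<Rightarrow> (nat \<Rightarrow> real mat) \<Rightarrow> real mat \<Rightarrow> real \<Rightarrow> bool" where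
  "root_rate_le n X G s \<longleftrightarrow>
     (\<forall>\<nu>. matrix_norm n \<nu> \<longrightarrow>
        limsup (\<lambda>k. ereal (root k (\<nu> (X k - G)))) \<le> ereal s)"

end

theory Submission
  imports Defs
begin

text \<open>
  Convergence: the iterates $Y_k$ started at $0$ increase to the minimal solution $G$. The identity
  $(I-G)^2 = I-N$ together with the simplicity of the eigenvalue $1$ of $N$ forces $Gu = u$. Any
  admissible sequence dominates the one started at $0$, and their difference, applied to $u$, is
  at most $u - Y_k u \to 0$.

  Spectrum: an eigenvalue $\lambda$ of $G$ gives the eigenvalue $2\lambda-\lambda^2$ of $N$. If
  $|\lambda| = 1$ then $|2-\lambda| \le 1$, so $\lambda = 1$; and $1$ is as simple for $G$ as for $N$.

  Rate: the error satisfies $2E_{k+1} = E_kG + GE_k + E_k^2$. For triangularizations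
  $G = P_1T_1P_1^{-1} = P_2T_2P_2^{-1}$ the matrix $P_2^{-1}E_kP_1$ satisfies a recursion whose linear
  part is triangular with diagonal entries $(t^{(1)}_{jj}+t^{(2)}_{ii})/2$. Putting the eigenvalue $1$
  first in $T_1$, $E_ku=0$ annihilates the first column; putting it last in $T_2$, $v^\top E_k=0$
  annihilates the last row. Only the eigenvalues named in the theorem survive.
\<close>

subsection \<open>Schur triangularization and simple eigenvalues\<close>

text \<open>The linear part of the error recursion, E -> (E G + G E)/2, has the eigenvalues
  (lambda_i + lambda_j)/2, and the pair (1, 1) contributes the value 1. Linearization alone
  therefore gives no contraction, which is why convergence comes from the order argument. Once E_k
  -> 0 is known, the quadratic term is a relative perturbation as small as desired, and the rate
  does not depend on the size of E_0.

  Fixing u removes the pairs whose index on the right factor is 1, and exactly the pairs in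
  \<open>sigma\<close> remain. Fixing v as well removes index 1 on the left, and the triangle
  inequality leaves |lambda_2|. A single triangularization need not show both effects: an upper
  triangular form exhibits a right eigenvector for its first diagonal entry and a left eigenvector
  for its last. The price of two forms is a constant matrix between the two factors of the quadratic
  term.

  G may fail to be diagonalizable; weights on the entries absorb the strictly triangular parts up to
  an arbitrarily small loss in the rate, which the limsup of k-th roots does not see.\<close>

lemma mult_mat_sum:
  assumes "A \<in> carrier_mat n m" "B \<in> carrier_mat m k" "i < n" "j < k"
  shows "(A * B) $$ (i, j) = (\<Sum>l<m. A $$ (i, l) * B $$ (l, j))"
  using assms by (simp add: scalar_prod_def lessThan_atLeast0)

lemma mult_mat_vec_sum:
  assumes "A \<in> carrier_mat n m" "x \<in> carrier_vec m" "i < n"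
  shows "(A *\<^sub>v x) $ i = (\<Sum>l<m. A $$ (i, l) * x $ l)"
  using assms by (simp add: scalar_prod_def lessThan_atLeast0)

text \<open>Back substitution from the bottom: once the later coordinates vanish, row
  \<open>i\<close> reads \<open>(T $$ (i, i) - c) * x $ i = 0\<close>. Only position 0 may carry the
  eigenvalue \<open>c\<close>.\<close>

lemma upper_triangular_eigenvector:
  fixes T :: "'a::idom mat"
  assumes T: "T \<in> carrier_mat n n" "upper_triangular T" and x: "x \<in> carrier_vec n"
    and ev: "T *\<^sub>v x = c \<cdot>\<^sub>v x" and ne: "\<And>i. 0 < i \<Longrightarrow> i < n \<Longrightarrow> T $$ (i, i) \<noteq> c"
  shows "0 < i \<Longrightarrow> i < n \<Longrightarrow> x $ i = 0"
proof (induction "n - i" arbitrary: i rule: less_induct)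
  case less
  have *: "T $$ (i, l) * x $ l = (if l = i then T $$ (i, i) * x $ i else 0)" if "l < n" for l
  proof (cases l i rule: linorder_cases)
    case greater
    with less that have "x $ l = 0" by (intro less.hyps) auto
    with greater show ?thesis by auto
  qed (use less T that in \<open>auto elim: upper_triangularD\<close>)
  have "c * x $ i = (\<Sum>l<n. T $$ (i, l) * x $ l)"
    using mult_mat_vec_sum[OF T(1) x less.prems(2)] ev less.prems(2) x by simp
  also have "\<dots> = (\<Sum>l<n. if l = i then T $$ (i, i) * x $ i else 0)"
    by (intro sum.cong refl) (simp only: * lessThan_iff)
  also have "\<dots> = T $$ (i, i) * x $ i"
    using less.prems by simp
  finally show ?case using ne[OF less.prems] by simp
qed

lemma schur_triangularization:
  fixes A :: "complex mat"
  assumes A: "A \<in> carrier_mat n n" and c: "char_poly A = (\<Prod>e\<leftarrow>es. [:- e, 1:])"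
  obtains T P Q where "T \<in> carrier_mat n n" "P \<in> carrier_mat n n" "Q \<in> carrier_mat n n"
    "P * Q = 1\<^sub>m n" "Q * P = 1\<^sub>m n" "A = P * T * Q" "upper_triangular T"
    "length es = n" "\<And>i. i < n \<Longrightarrow> T $$ (i, i) = es ! i"
proof -
  obtain T P Q where s: "schur_decomposition A es = (T, P, Q)"
    by (cases "schur_decomposition A es") auto
  note * = schur_decomposition[OF A c s]
  note w = similar_mat_witD2[OF A conjunct1[OF *]]
  have d: "diag_mat T = es" using * by simp
  have "length es = n" unfolding d[symmetric] diag_mat_def using w(5) by simp
  moreover have "T $$ (i, i) = es ! i" if "i < n" for i
    unfolding d[symmetric] diag_mat_def using w(5) that by simp
  ultimately show ?thesis using that[OF w(5,6,7,1,2,3)] * by blast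
qed

text \<open>In the coordinates of a triangular form with \<open>c\<close> in front, every
  eigenvector for \<open>c\<close> is supported on coordinate 0, so two of them differ by the
  quotient of these coordinates. For \<open>u\<close> this coordinate is nonzero, since otherwise
  \<open>u\<close> would vanish.\<close>

lemma simple_eigenspace:
  fixes A :: "complex mat"
  assumes A: "A \<in> carrier_mat n n" and c: "char_poly A = (\<Prod>e\<leftarrow>c # es. [:- e, 1:])"
    and ce: "c \<notin> set es"
    and u: "u \<in> carrier_vec n" "A *\<^sub>v u = c \<cdot>\<^sub>v u" "u \<noteq> 0\<^sub>v n"
    and x: "x \<in> carrier_vec n" "A *\<^sub>v x = c \<cdot>\<^sub>v x"
  shows "\<exists>a. x = a \<cdot>\<^sub>v u"
proof -
  obtain T P Q where s: "T \<in> carrier_mat n n" "P \<in> carrier_mat n n" "Q \<in> carrier_mat n n"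
    "P * Q = 1\<^sub>m n" "Q * P = 1\<^sub>m n" "A = P * T * Q" "upper_triangular T"
    "length (c # es) = n" "\<And>i. i < n \<Longrightarrow> T $$ (i, i) = (c # es) ! i"
    using schur_triangularization[OF A c] by metis
  have sup: "(Q *\<^sub>v y) $ i = 0" if y: "y \<in> carrier_vec n" "A *\<^sub>v y = c \<cdot>\<^sub>v y"
    and i: "0 < i" "i < n" for y i
  proof (rule upper_triangular_eigenvector[OF s(1,7) _ _ _ i])
    have "T *\<^sub>v (Q *\<^sub>v y) = (Q * P) *\<^sub>v (T *\<^sub>v (Q *\<^sub>v y))"
      using s y by simp
    also have "\<dots> = Q *\<^sub>v (A *\<^sub>v y)"
      unfolding s(6) using s(1-3) y
      by (simp add: assoc_mult_mat_vec[of _ n n _ n])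
    also have "\<dots> = c \<cdot>\<^sub>v (Q *\<^sub>v y)" using s y by (simp add: mult_mat_vec[of _ n n])
    finally show "T *\<^sub>v (Q *\<^sub>v y) = c \<cdot>\<^sub>v (Q *\<^sub>v y)" .
    show "T $$ (i, i) \<noteq> c" if "0 < i" "i < n" for i
      using s(9)[of i] s(8) that ce by (cases i) (auto simp: in_set_conv_nth)
  qed (use s y in auto)
  have PQy: "P *\<^sub>v (Q *\<^sub>v y) = y" if "y \<in> carrier_vec n" for y
    using that s by (simp add: assoc_mult_mat_vec[of _ n n _ n, symmetric])
  have n: "0 < n" using s(8) by auto
  have nz: "(Q *\<^sub>v u) $ 0 \<noteq> 0"
  proof
    assume "(Q *\<^sub>v u) $ 0 = 0"
    then have "Q *\<^sub>v u = 0\<^sub>v n"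
      using s(3) sup[OF u(1,2)] by (intro eq_vecI) (simp_all, metis neq0_conv)
    then show False using PQy[OF u(1)] u(3) s(2) by auto
  qed
  define a :: complex where "a = (Q *\<^sub>v x) $ 0 / (Q *\<^sub>v u) $ 0"
  have "(Q *\<^sub>v x) $ i = a * (Q *\<^sub>v u) $ i" if "i < n" for i
    using nz sup[OF u(1,2) _ that] sup[OF x _ that] by (cases "i = 0") (auto simp: a_def)
  then have "Q *\<^sub>v x = a \<cdot>\<^sub>v (Q *\<^sub>v u)"
    using s(3) by (intro eq_vecI) auto
  then have "x = P *\<^sub>v (a \<cdot>\<^sub>v (Q *\<^sub>v u))" using PQy[OF x(1)] by simp
  also have "\<dots> = a \<cdot>\<^sub>v u" using s(2,3) u(1) PQy[OF u(1)] by (simp add: mult_mat_vec[of _ n n])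
  finally show ?thesis by blast
qed

lemma order_prod_linear:
  fixes x :: "'a::idom"
  shows "order x (\<Prod>e\<leftarrow>es. [:- e, 1:]) = count_list es x"
proof (induction es)
  case (Cons e es)
  have "(\<Prod>e\<leftarrow>es'. [:- e, 1:]) \<noteq> 0" for es' :: "'a list"
    by (induction es') (auto simp del: mult_pCons_left)
  from this[of "e # es"]
  have "order x (\<Prod>e\<leftarrow>e # es. [:- e, 1:]) = order x [:- e, 1:] + count_list es x"
    unfolding list.map(2) prod_list.Cons Cons[symmetric] by (rule Polynomial.order_mult)
  also have "order x [:- e, 1:] = (if e = x then 1 else 0)"
    using order_power_n_n[of e 1] by (simp add: order_0I)
  finally show ?case by simp
qed (simp add: order_0I)

section \<open>The relation \<open>N = 2 G - G * G\<close>: fixed vectors and spectra\<close>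

lemma quad_carrier:
  fixes G :: "'a::comm_ring_1 mat"
  assumes "G \<in> carrier_mat n n"
  shows "2 \<cdot>\<^sub>m G - G * G \<in> carrier_mat n n"
  by (rule minus_carrier_mat) (use assms in simp)

lemma quad_mult_vec:
  fixes G :: "'a::field mat"
  assumes G: "G \<in> carrier_mat n n" and N: "N = 2 \<cdot>\<^sub>m G - G * G" and x: "x \<in> carrier_vec n"
  shows "N *\<^sub>v x = 2 \<cdot>\<^sub>v (G *\<^sub>v x) - G *\<^sub>v (G *\<^sub>v x)"
proof -
  have "N *\<^sub>v x = (2 \<cdot>\<^sub>m G) *\<^sub>v x - (G * G) *\<^sub>v x"
    unfolding N using G x by (intro minus_mult_distrib_mat_vec[of _ n n]) auto
  also have "(2 \<cdot>\<^sub>m G) *\<^sub>v x = 2 \<cdot>\<^sub>v (G *\<^sub>v x)"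
    using G x by (intro eq_vecI) auto
  also have "(G * G) *\<^sub>v x = G *\<^sub>v (G *\<^sub>v x)"
    using G x by (rule assoc_mult_mat_vec[of _ n n _ n, OF _ G])
  finally show ?thesis .
qed

lemma quad_fixed_vec:
  fixes G :: "'a::field mat"
  assumes G: "G \<in> carrier_mat n n" and N: "N = 2 \<cdot>\<^sub>m G - G * G" and x: "x \<in> carrier_vec n"
    and Gx: "G *\<^sub>v x = x"
  shows "N *\<^sub>v x = x"
  unfolding quad_mult_vec[OF G N x] Gx using x by (intro eq_vecI) auto

text \<open>Spectral mapping with multiplicities: \<open>2 T - T * T\<close> is again upper
  triangular, so its diagonal lists the images of all eigenvalues, each as often as it
  occurs.\<close>

lemma char_poly_quad:
  fixes G :: "complex mat"
  assumes G: "G \<in> carrier_mat n n" and N: "N = 2 \<cdot>\<^sub>m G - G * G"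
    and c: "char_poly G = (\<Prod>e\<leftarrow>es. [:- e, 1:])"
  shows "char_poly N = (\<Prod>e\<leftarrow>map (\<lambda>e. 2 * e - e\<^sup>2) es. [:- e, 1:])"
proof -
  obtain T P Q where s: "T \<in> carrier_mat n n" "P \<in> carrier_mat n n" "Q \<in> carrier_mat n n"
    "P * Q = 1\<^sub>m n" "Q * P = 1\<^sub>m n" "G = P * T * Q" "upper_triangular T"
    "length es = n" "\<And>i. i < n \<Longrightarrow> T $$ (i, i) = es ! i"
    using schur_triangularization[OF G c] by metis
  define T' where "T' = 2 \<cdot>\<^sub>m T - T * T"
  have T': "T' \<in> carrier_mat n n" using quad_carrier[OF s(1)] by (simp add: T'_def)
  have "G * G = P * T * (Q * P) * T * Q"
    unfolding s(6) using s(1-3) by (simp add: assoc_mult_mat[of _ n n _ n _ n])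
  also have "\<dots> = P * (T * T) * Q"
    unfolding s(5) using s(1-3) by (simp add: assoc_mult_mat[of _ n n _ n _ n])
  finally have GG: "G * G = P * (T * T) * Q" .
  have "N = P * T' * Q"
    unfolding N GG unfolding T'_def s(6) using s(1-3)
    by (simp add: mult_minus_distrib_mat[of _ n n _ n] minus_mult_distrib_mat[of _ n n _ _ n]
        mult_smult_distrib[of _ n n _ n] mult_smult_assoc_mat[of _ n n _ n])
  then have "similar_mat N T'"
    using s T' by (intro similar_matI[of _ _ P Q n]) auto
  then have 1: "char_poly N = char_poly T'" by (rule char_poly_similar)
  have TT: "T' $$ (i, j) = 2 * T $$ (i, j) - (\<Sum>l<n. T $$ (i, l) * T $$ (l, j))" if "i < n" "j < n" for i j
    using that s(1) mult_mat_sum[OF s(1) s(1) that] by (simp add: T'_def)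
  have ut: "T $$ (i, j) = 0" if "j < i" "i < n" for i j
    using that s(1,7) by auto
  have "upper_triangular T'"
  proof (rule upper_triangularI)
    fix i j assume ij: "j < i" "i < dim_row T'"
    then have "(\<Sum>l<n. T $$ (i, l) * T $$ (l, j)) = 0"
      using T' ut by (intro sum.neutral ballI) (metis carrier_matD(1) lessThan_iff less_linear less_trans mult_eq_0_iff)
    then show "T' $$ (i, j) = 0" using TT[of i j] ut[of j i] ij T' by simp
  qed
  from char_poly_upper_triangular[OF T' this]
  have 2: "char_poly T' = (\<Prod>e\<leftarrow>diag_mat T'. [:- e, 1:])" .
  have "T' $$ (i, i) = 2 * es ! i - (es ! i)\<^sup>2" if "i < n" for i
  proof -
    have "(\<Sum>l<n. T $$ (i, l) * T $$ (l, i)) = (\<Sum>l<n. if l = i then T $$ (i, i) * T $$ (i, i) else 0)"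
      using ut that by (intro sum.cong refl) (auto, metis less_linear)
    then show ?thesis using TT[OF that that] s(9)[OF that] that by (simp add: power2_eq_square)
  qed
  then have "diag_mat T' = map (\<lambda>e. 2 * e - e\<^sup>2) es"
    using s(8) T' by (intro nth_equalityI) (auto simp: diag_mat_def)
  then show ?thesis using 1 2 by simp
qed

text \<open>Embedding the reals into the complex numbers preserves the order of a root, so
  simplicity can be read off any complex factorization.\<close>

lemma simple_eigenvalue_complex_spectrum:
  assumes A: "A \<in> carrier_mat n n" and simple: "simple_eigenvalue A x"
    and c: "char_poly (map_mat complex_of_real A) = (\<Prod>e\<leftarrow>es. [:- e, 1:])"
  shows "count_list es (complex_of_real x) = 1"
proof -
  have "order (complex_of_real x) (char_poly (map_mat complex_of_real A)) = order x (char_poly A)"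
    unfolding of_real_hom.char_poly_hom[OF A]
    by (rule map_poly_inj_idom_divide_hom.order_hom) unfold_locales
  then show ?thesis using simple unfolding c order_prod_linear simple_eigenvalue_def by simp
qed

text \<open>The vector \<open>x\<close> is complex because it will be a column or row of a complex
  triangularization, while the spanning vector stays real.\<close>

lemma simple_eigenspace_real:
  fixes A :: "real mat"
  assumes A: "A \<in> carrier_mat n n" and simple: "simple_eigenvalue A c"
    and u: "u \<in> carrier_vec n" "A *\<^sub>v u = c \<cdot>\<^sub>v u" "u \<noteq> 0\<^sub>v n"
    and x: "x \<in> carrier_vec n" "map_mat complex_of_real A *\<^sub>v x = complex_of_real c \<cdot>\<^sub>v x"
  shows "\<exists>a. x = a \<cdot>\<^sub>v map_vec complex_of_real u"
proof -
  let ?A = "map_mat complex_of_real A" and ?u = "map_vec complex_of_real u"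
  have A': "?A \<in> carrier_mat n n" using A by simp
  obtain as where as: "char_poly ?A = (\<Prod>e\<leftarrow>as. [:- e, 1:])"
    using char_poly_factorized[OF A'] by auto
  have cnt: "count_list as (complex_of_real c) = 1"
    by (rule simple_eigenvalue_complex_spectrum[OF A simple as])
  then have "complex_of_real c \<in> set as" by (metis count_notin zero_neq_one)
  \<comment> \<open>Moving the only occurrence of \<open>c\<close> to the front leaves a list
    without \<open>c\<close>.\<close>
  then obtain ys zs where yz: "as = ys @ complex_of_real c # zs" by (meson split_list)
  then have 1: "char_poly ?A = (\<Prod>e\<leftarrow>complex_of_real c # (ys @ zs). [:- e, 1:])"
    using as by (simp del: mult_pCons_left mult_pCons_right add: mult.left_commute)
  have 2: "complex_of_real c \<notin> set (ys @ zs)"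
    using cnt unfolding yz by (auto simp: count_list_0_iff)
  have 3: "?A *\<^sub>v ?u = complex_of_real c \<cdot>\<^sub>v ?u"
    using of_real_hom.mult_mat_vec_hom[OF A u(1), where 'a = complex, symmetric] u(2)
    by (simp add: of_real_hom.vec_hom_smult)
  have 4: "?u \<noteq> 0\<^sub>v n" using u(3) by (metis of_real_hom.vec_hom_zero_iff u(1))
  show ?thesis using simple_eigenspace[OF A' 1 2 _ 3 4 x] u(1) by simp
qed

text \<open>The vector w = (I - G) u satisfies (I - G) w = (I - N) u = 0. Hence w is fixed by G, so
  by N, and simplicity makes it a multiple of u.\<close>

lemma quad_simple_fixed:
  fixes G N :: "real mat"
  assumes G: "G \<in> carrier_mat n n" and N: "N = 2 \<cdot>\<^sub>m G - G * G"
    and simple: "simple_eigenvalue N 1"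
    and u: "u \<in> carrier_vec n" "N *\<^sub>v u = u" "u \<noteq> 0\<^sub>v n"
  shows "G *\<^sub>v u = u"
proof -
  have Nc: "N \<in> carrier_mat n n" using quad_carrier[OF G] N by simp
  define w where "w = u - G *\<^sub>v u"
  have w: "w \<in> carrier_vec n" using G u by (simp add: w_def)
  have "u $ i = 2 * (G *\<^sub>v u) $ i - (G *\<^sub>v (G *\<^sub>v u)) $ i" if "i < n" for i
    using arg_cong[OF quad_mult_vec[OF G N u(1)], of "\<lambda>x. x $ i"] u(2) G that
    by (simp del: index_mult_mat_vec)
  moreover have "G *\<^sub>v w = G *\<^sub>v u - G *\<^sub>v (G *\<^sub>v u)"
    unfolding w_def using G u(1) by (intro mult_minus_distrib_mat_vec[of _ n n]) auto
  ultimately have Gw: "G *\<^sub>v w = w"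
    using G u(1) w by (intro eq_vecI) (auto simp: w_def simp del: index_mult_mat_vec)
  have "N *\<^sub>v w = w" by (rule quad_fixed_vec[OF G N w Gw])
  then have "map_mat complex_of_real N *\<^sub>v map_vec complex_of_real w = complex_of_real 1 \<cdot>\<^sub>v map_vec complex_of_real w"
    using of_real_hom.mult_mat_vec_hom[OF Nc w, where 'a = complex, symmetric] by simp
  then obtain a where a: "map_vec complex_of_real w = a \<cdot>\<^sub>v map_vec complex_of_real u"
    using simple_eigenspace_real[OF Nc simple u(1) _ u(3)] u(2) w by (metis one_smult_vec map_carrier_vec)
  have wa: "w = Re a \<cdot>\<^sub>v u"
  proof (intro eq_vecI)
    fix i assume "i < dim_vec (Re a \<cdot>\<^sub>v u)"
    then have i: "i < n" using u(1) by simp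
    from arg_cong[OF a, of "\<lambda>x. Re (x $ i)"] i w u(1) show "w $ i = (Re a \<cdot>\<^sub>v u) $ i" by simp
  qed (use w u in simp)
  \<comment> \<open>A nonzero multiple of \<open>u\<close> fixed by \<open>G\<close> would make
    \<open>u\<close> itself fixed, and then \<open>w\<close> would be 0 after all.\<close>
  have "Re a = 0"
  proof (rule ccontr)
    assume nz: "Re a \<noteq> 0"
    have "Re a \<cdot>\<^sub>v (G *\<^sub>v u) = Re a \<cdot>\<^sub>v u"
      using Gw unfolding wa using G u(1) by (simp add: mult_mat_vec[of _ n n])
    then have "G *\<^sub>v u = u"
      using nz G u(1) by (intro eq_vecI) (auto simp: vec_eq_iff simp del: index_mult_mat_vec)
    then have "w = 0\<^sub>v n" using u(1) by (simp add: w_def)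
    then show False using wa nz u(1,3) by (auto simp: vec_eq_iff)
  qed
  then have w0: "w = 0\<^sub>v n" using wa u(1) by (intro eq_vecI) simp_all
  show ?thesis
  proof (intro eq_vecI)
    fix i assume "i < dim_vec u"
    then show "(G *\<^sub>v u) $ i = u $ i"
      using arg_cong[OF w0, of "\<lambda>x. x $ i"] u(1) G by (simp add: w_def del: index_mult_mat_vec)
  qed (use G u in simp)
qed

text \<open>The condition on \<open>u\<close> says that \<open>B\<close> has norm at most 1 in the
  sup norm weighted by \<open>u\<close>. The index \<open>m\<close> is where the eigenvector attains
  this norm, and \<open>q m\<close> is its value.\<close>

lemma nonneg_mat_eigenvalue_le_1:
  fixes B :: "real mat"
  assumes B: "B \<in> carrier_mat n n" "\<And>i j. i < n \<Longrightarrow> j < n \<Longrightarrow> 0 \<le> B $$ (i, j)"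
    and u: "\<And>i. i < n \<Longrightarrow> 0 < u i" "\<And>i. i < n \<Longrightarrow> (\<Sum>j<n. B $$ (i, j) * u j) \<le> u i"
    and ev: "eigenvalue (map_mat complex_of_real B) x"
  shows "cmod x \<le> 1"
proof -
  let ?B = "map_mat complex_of_real B"
  obtain z where z: "z \<in> carrier_vec n" "z \<noteq> 0\<^sub>v n" "?B *\<^sub>v z = x \<cdot>\<^sub>v z"
    using ev B(1) unfolding eigenvalue_def eigenvector_def by auto
  obtain p where p: "p < n" "z $ p \<noteq> 0"
    using z(1,2) by (metis carrier_vecD eq_vecI index_zero_vec(1) index_zero_vec(2))
  define q where "q i = cmod (z $ i) / u i" for i
  obtain m where m: "m < n" "\<And>i. i < n \<Longrightarrow> q i \<le> q m"
  proof -
    have "Max (q ` {..<n}) \<in> q ` {..<n}" using p by (intro Max_in) auto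
    then obtain m where "m < n" "q m = Max (q ` {..<n})" by auto
    then show ?thesis using that[of m] by simp
  qed
  have qm: "q m > 0"
    using m(2)[OF p(1)] p u(1)[OF p(1)] by (smt (verit) divide_pos_pos q_def zero_less_norm_iff)
  have zle: "cmod (z $ i) \<le> q m * u i" if "i < n" for i
    using m(2)[OF that] u(1)[OF that] by (simp add: q_def[of i] field_simps)
  have zm: "cmod (z $ m) = q m * u m"
    using u(1)[OF m(1)] by (simp add: q_def)
  have "cmod x * cmod (z $ m) = cmod (\<Sum>l<n. ?B $$ (m, l) * z $ l)"
    using mult_mat_vec_sum[of ?B n n z m] z B(1) m(1) by (simp add: norm_mult[symmetric])
  also have "\<dots> \<le> (\<Sum>l<n. B $$ (m, l) * (q m * u l))"
    using B m(1) zle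
    by (intro order.trans[OF norm_sum] sum_mono) (auto simp: norm_mult intro!: mult_left_mono)
  also have "\<dots> = q m * (\<Sum>l<n. B $$ (m, l) * u l)"
    by (simp add: sum_distrib_left mult_ac)
  also have "\<dots> \<le> q m * u m" using u(2)[OF m(1)] qm by simp
  finally have "cmod x * (q m * u m) \<le> 1 * (q m * u m)" using zm by simp
  moreover have "0 < q m * u m" using qm u(1)[OF m(1)] by simp
  ultimately show ?thesis by (rule mult_right_le_imp_le)
qed

subsection \<open>Rates of convergence of triangular recursions\<close>

text \<open>In a suitable weighted sup norm the linear part is hardly larger than its diagonal part,
  and \<open>lim\<close> makes the quadratic part negligible from some index on. Entry (i, j) has
  the diagonal coefficient \<open>(T1 j j + T2 i i) / 2\<close>; where the entry is 0, that
  coefficient needs no bound, hence the disjunction in \<open>diag\<close>.\<close>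

lemma triangular_recursion_rate:
  fixes e :: "nat \<Rightarrow> nat \<Rightarrow> nat \<Rightarrow> complex" and T1 T2 M :: "nat \<Rightarrow> nat \<Rightarrow> complex"
  assumes rec: "\<And>k i j. i < n \<Longrightarrow> j < n \<Longrightarrow> e (Suc k) i j =
      ((\<Sum>l<n. e k i l * T1 l j) + (\<Sum>l<n. T2 i l * e k l j) +
       (\<Sum>l<n. \<Sum>m<n. e k i l * M l m * e k m j)) / 2"
    and T1: "\<And>i j. j < i \<Longrightarrow> i < n \<Longrightarrow> T1 i j = 0"
    and T2: "\<And>i j. j < i \<Longrightarrow> i < n \<Longrightarrow> T2 i j = 0"
    and lim: "\<And>i j. i < n \<Longrightarrow> j < n \<Longrightarrow> (\<lambda>k. e k i j) \<longlonglongrightarrow> 0"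
    and diag: "\<And>k i j. i < n \<Longrightarrow> j < n \<Longrightarrow> e k i j = 0 \<or> cmod (T1 j j + T2 i i) \<le> 2 * s"
    and s: "0 \<le> s" "s < r"
  shows "\<exists>C. \<forall>\<^sub>F k in sequentially. \<forall>i<n. \<forall>j<n. cmod (e k i j) \<le> C * r ^ k"
proof -
  define \<delta> where "\<delta> = r - s"
  have \<delta>: "\<delta> > 0" using s by (simp add: \<delta>_def)
  define \<tau> where "\<tau> = (\<Sum>i<n. \<Sum>j<n. cmod (T1 i j) + cmod (T2 i j) + cmod (M i j))"
  have "cmod (T1 i j) + cmod (T2 i j) + cmod (M i j) \<le> \<tau>" if "i < n" "j < n" for i j
  proof -
    have "cmod (T1 i j) + cmod (T2 i j) + cmod (M i j)
        \<le> (\<Sum>j<n. cmod (T1 i j) + cmod (T2 i j) + cmod (M i j))"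
      using that by (intro member_le_sum) auto
    also have "\<dots> \<le> \<tau>"
      unfolding \<tau>_def
      using that by (intro member_le_sum[of i _ "\<lambda>i. \<Sum>j<n. cmod (T1 i j) + cmod (T2 i j) + cmod (M i j)"])
        (auto intro!: sum_nonneg add_nonneg_nonneg)
    finally show ?thesis .
  qed
  then have \<tau>: "cmod (T1 i j) \<le> \<tau>" "cmod (T2 i j) \<le> \<tau>" "cmod (M i j) \<le> \<tau>" if "i < n" "j < n" for i j
    using that by (smt (verit) norm_ge_zero)+
  have \<tau>0: "\<tau> \<ge> 0" by (auto simp: \<tau>_def intro!: sum_nonneg add_nonneg_nonneg)
  \<comment> \<open>Large enough that the strictly triangular parts, damped by \<open>1 / E\<close>,
    cost at most half of the margin \<open>\<delta> = r - s\<close>.\<close>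
  define E where "E = 1 + 2 * real n * \<tau> / \<delta>"
  have E1: "E \<ge> 1" using \<delta> \<tau>0 by (simp add: E_def)
  have nE: "real n * \<tau> / E \<le> \<delta> / 2"
  proof -
    have "2 * real n * \<tau> \<le> \<delta> * E" using \<delta> by (simp add: E_def field_simps)
    then show ?thesis using E1 by (simp add: field_simps)
  qed
  \<comment> \<open>The size below which the entries must fall for the quadratic term to cost at
    most the other half of the margin. The summand 1 keeps the denominator positive when
    \<open>\<tau>\<close> is 0.\<close>
  define \<eta> where "\<eta> = \<delta> / (real n * real n * \<tau> * E ^ n + 1)"
  have den: "real n * real n * \<tau> * E ^ n + 1 > 0"
    using \<tau>0 E1 by (intro add_nonneg_pos) auto
  have \<eta>: "\<eta> > 0" using \<delta> den by (simp add: \<eta>_def)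
  have n\<eta>: "real n * real n * \<eta> * \<tau> * E ^ n \<le> \<delta>"
  proof -
    have "real n * real n * \<eta> * \<tau> * E ^ n = \<delta> * ((real n * real n * \<tau> * E ^ n) / (real n * real n * \<tau> * E ^ n + 1))"
      by (simp add: \<eta>_def)
    also have "\<dots> \<le> \<delta> * 1" using \<delta> den by (intro mult_left_mono) auto
    finally show ?thesis by simp
  qed
  \<comment> \<open>Weighting entry (i, j) by the inverse of W i j turns the strictly triangular parts of T1 and T2
    into a perturbation of size 1 / E.\<close>
  define W where "W i j = E ^ (j + n - i)" for i j
  have W1: "1 \<le> W i j" "W i j \<le> E ^ (2 * n)" if "j < n" for i j
    using E1 that by (auto simp: W_def intro!: power_increasing)
  have Wj: "W i l \<le> W i j / E" if "l < j" "i < n" for i l j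
  proof -
    have "W i l * E \<le> W i j"
      unfolding W_def power_Suc2[symmetric] using E1 that by (intro power_increasing) auto
    then show ?thesis using E1 by (simp add: field_simps)
  qed
  have Wi: "W l j \<le> W i j / E" if "i < l" "l < n" for i l j
  proof -
    have "W l j * E \<le> W i j"
      unfolding W_def power_Suc2[symmetric] using E1 that by (intro power_increasing) auto
    then show ?thesis using E1 by (simp add: field_simps)
  qed
  have Wm: "W m j \<le> E ^ n * W i j" if "i < n" "m < n" for i m j
    unfolding W_def power_add[symmetric] using E1 that by (intro power_increasing) auto
  have step: "cmod (e (Suc k) i j) \<le> b * r * W i j"
    if b: "\<And>i j. i < n \<Longrightarrow> j < n \<Longrightarrow> cmod (e k i j) \<le> b * W i j" and b0: "b \<ge> 0"
      and small: "\<And>i j. i < n \<Longrightarrow> j < n \<Longrightarrow> cmod (e k i j) \<le> \<eta>"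
      and ij: "i < n" "j < n" for k i j b
  proof -
    define w where "w = b * W i j"
    have w0: "w \<ge> 0" using b0 W1(1)[OF ij(2), of i] by (simp add: w_def)
    define S1 where "S1 = (\<Sum>l\<in>{..<n}-{j}. e k i l * T1 l j)"
    define S2 where "S2 = (\<Sum>l\<in>{..<n}-{i}. T2 i l * e k l j)"
    define S3 where "S3 = (\<Sum>l<n. \<Sum>m<n. e k i l * M l m * e k m j)"
    have S1: "cmod S1 \<le> real n * (\<tau> * w / E)"
    proof -
      have "cmod (e k i l * T1 l j) \<le> \<tau> * w / E" if l: "l \<in> {..<n} - {j}" for l
      proof (cases "l < j")
        case True
        have "cmod (e k i l * T1 l j) \<le> (b * W i l) * \<tau>"
          unfolding norm_mult using l ij b \<tau> b0 W1(1)[of l i] by (intro mult_mono) auto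
        also have "\<dots> \<le> (b * (W i j / E)) * \<tau>"
          using Wj[OF True ij(1)] b0 \<tau>0 by (intro mult_right_mono mult_left_mono)
        finally show ?thesis by (simp add: w_def mult_ac)
      next
        case False
        then show ?thesis using T1[of j l] l w0 \<tau>0 E1 by auto
      qed
      then have "cmod S1 \<le> real (card ({..<n} - {j})) * (\<tau> * w / E)"
        unfolding S1_def by (intro sum_norm_bound)
      also have "\<dots> \<le> real n * (\<tau> * w / E)"
        using w0 \<tau>0 E1 card_Diff1_le[of "{..<n}" j] by (intro mult_right_mono) auto
      finally show ?thesis .
    qed
    have S2: "cmod S2 \<le> real n * (\<tau> * w / E)"
    proof -
      have "cmod (T2 i l * e k l j) \<le> \<tau> * w / E" if l: "l \<in> {..<n} - {i}" for l
      proof (cases "i < l")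
        case True
        have "cmod (T2 i l * e k l j) \<le> \<tau> * (b * W l j)"
          unfolding norm_mult using l ij b \<tau> b0 \<tau>0 W1(1)[of j l] by (intro mult_mono) auto
        also have "\<dots> \<le> \<tau> * (b * (W i j / E))"
          using Wi[OF True] l b0 \<tau>0 by (intro mult_left_mono) auto
        finally show ?thesis by (simp add: w_def mult_ac)
      next
        case False
        then show ?thesis using T2[of l i] l w0 \<tau>0 E1 ij by auto
      qed
      then have "cmod S2 \<le> real (card ({..<n} - {i})) * (\<tau> * w / E)"
        unfolding S2_def by (intro sum_norm_bound)
      also have "\<dots> \<le> real n * (\<tau> * w / E)"
        using w0 \<tau>0 E1 card_Diff1_le[of "{..<n}" i] by (intro mult_right_mono) auto
      finally show ?thesis .
    qed
    have S3: "cmod S3 \<le> real n * (real n * (\<eta> * \<tau> * (E ^ n * w)))"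
    proof -
      \<comment> \<open>Only the right factor carries the weight; the left one is merely bounded by
        \<open>\<eta>\<close>. Passing from the weight of row \<open>m\<close> to that of row
        \<open>i\<close> costs at most \<open>E ^ n\<close>.\<close>
      have *: "cmod (e k i l * M l m * e k m j) \<le> \<eta> * \<tau> * (E ^ n * w)" if "l < n" "m < n" for l m
      proof -
        have "cmod (e k m j) \<le> b * (E ^ n * W i j)"
          using b[OF that(2) ij(2)] mult_left_mono[OF Wm[OF ij(1) that(2)] b0, of j] by linarith
        then have "cmod (e k m j) \<le> E ^ n * w" by (simp add: w_def mult_ac)
        then show ?thesis
          unfolding norm_mult using small[OF ij(1) that(1)] \<tau>[OF that] \<eta> \<tau>0
          by (intro mult_mono) auto
      qed
      have "cmod (\<Sum>m<n. e k i l * M l m * e k m j) \<le> real n * (\<eta> * \<tau> * (E ^ n * w))" if "l < n" for l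
        using sum_norm_bound[of "{..<n}" "\<lambda>m. e k i l * M l m * e k m j"] *[OF that] by simp
      then show ?thesis
        unfolding S3_def using sum_norm_bound[of "{..<n}" "\<lambda>l. \<Sum>m<n. e k i l * M l m * e k m j"] by simp
    qed
    have D: "cmod (e k i j * (T1 j j + T2 i i)) \<le> 2 * s * w"
      using diag[OF ij, of k]
    proof
      assume d: "cmod (T1 j j + T2 i i) \<le> 2 * s"
      have "cmod (e k i j * (T1 j j + T2 i i)) \<le> w * (2 * s)"
        unfolding norm_mult using b[OF ij] d w0 by (intro mult_mono) (auto simp: w_def)
      then show ?thesis by (simp add: mult_ac)
    qed (use s w0 in simp)
    have "(\<Sum>l<n. e k i l * T1 l j) = e k i j * T1 j j + S1"
      unfolding S1_def using ij by (intro sum.remove) auto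
    moreover have "(\<Sum>l<n. T2 i l * e k l j) = T2 i i * e k i j + S2"
      unfolding S2_def using ij by (intro sum.remove) auto
    ultimately have "e (Suc k) i j = (e k i j * (T1 j j + T2 i i) + S1 + S2 + S3) / 2"
      unfolding rec[OF ij] S3_def by (simp add: algebra_simps)
    then have "cmod (e (Suc k) i j) = cmod (e k i j * (T1 j j + T2 i i) + S1 + S2 + S3) / 2"
      by (simp only: norm_divide norm_numeral)
    also have "\<dots> \<le> (2 * s * w + real n * (\<tau> * w / E) + real n * (\<tau> * w / E)
        + real n * (real n * (\<eta> * \<tau> * (E ^ n * w)))) / 2"
      using norm_triangle_mono[OF norm_triangle_mono[OF norm_triangle_mono[OF D S1] S2] S3] by simp
    also have "\<dots> = w * (s + real n * \<tau> / E + real n * real n * \<eta> * \<tau> * E ^ n / 2)"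
      by (simp add: field_simps)
    also have "\<dots> \<le> w * r"
    proof (rule mult_left_mono[OF _ w0])
      have "s + a + b / 2 \<le> r" if "a \<le> \<delta> / 2" "b \<le> \<delta>" for a b
        using that unfolding \<delta>_def by argo
      from this[OF nE n\<eta>] show "s + real n * \<tau> / E + real n * real n * \<eta> * \<tau> * E ^ n / 2 \<le> r" .
    qed
    finally show ?thesis by (simp add: w_def mult_ac)
  qed
  \<comment> \<open>There are finitely many entries, so one index \<open>K\<close> makes all of them
    small from there on.\<close>
  have "\<forall>\<^sub>F k in sequentially. \<forall>p\<in>{..<n}\<times>{..<n}. cmod (e k (fst p) (snd p)) < \<eta>"
  proof (intro eventually_ball_finite ballI)
    fix p assume "p \<in> {..<n} \<times> {..<n}"
    then have "(\<lambda>k. cmod (e k (fst p) (snd p))) \<longlonglongrightarrow> 0"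
      using lim[of "fst p" "snd p"] by (intro tendsto_norm_zero) auto
    then show "\<forall>\<^sub>F k in sequentially. cmod (e k (fst p) (snd p)) < \<eta>"
      using \<eta> by (rule order_tendstoD(2))
  qed simp
  then obtain K where K: "\<And>k i j. k \<ge> K \<Longrightarrow> i < n \<Longrightarrow> j < n \<Longrightarrow> cmod (e k i j) \<le> \<eta>"
    unfolding eventually_sequentially by (fastforce intro: less_imp_le)
  have r0: "r > 0" using s by simp
  have bound: "cmod (e (K + m) i j) \<le> (\<eta> * r ^ m) * W i j" if "i < n" "j < n" for m i j
    using that
  proof (induction m arbitrary: i j)
    case 0
    have "cmod (e K i j) \<le> \<eta> * 1" using K[of K i j] 0 by simp
    also have "\<dots> \<le> \<eta> * W i j" using W1(1) 0 \<eta> by (intro mult_left_mono) auto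
    finally show ?case by simp
  next
    case (Suc m)
    show ?case
      using step[of "K + m" "\<eta> * r ^ m" i j] Suc K[of "K + m"] \<eta> r0 by (simp add: mult_ac)
  qed
  \<comment> \<open>The constant absorbs the late start at \<open>K\<close> and the largest
    weight.\<close>
  have "cmod (e k i j) \<le> (\<eta> * E ^ (2 * n) / r ^ K) * r ^ k" if "k \<ge> K" "i < n" "j < n" for k i j
  proof -
    have "cmod (e k i j) \<le> (\<eta> * r ^ (k - K)) * W i j" using bound[OF that(2,3), of "k - K"] that by simp
    also have "\<dots> \<le> (\<eta> * r ^ (k - K)) * E ^ (2 * n)"
      using W1(2)[OF that(3), of i] \<eta> r0 by (intro mult_left_mono) auto
    also have "\<dots> = (\<eta> * E ^ (2 * n) / r ^ K) * r ^ k"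
      using r0 that by (simp add: power_diff field_simps)
    finally show ?thesis .
  qed
  then show ?thesis unfolding eventually_sequentially by blast
qed

section \<open>From geometric bounds on the entries to root rates in an arbitrary norm\<close>

lemma matrix_norm_entry_bound:
  assumes "matrix_norm n \<nu>"
  shows "\<exists>C\<ge>0. \<forall>A\<in>carrier_mat n n. \<forall>b\<ge>0. (\<forall>i<n. \<forall>j<n. \<bar>A $$ (i, j)\<bar> \<le> b) \<longrightarrow> \<nu> A \<le> C * b"
proof -
  \<comment> \<open>The matrix units. Expanding in them uses only homogeneity and the triangle
    inequality, and the sum of their norms is the required constant.\<close>
  define U where "U p = mat n n (\<lambda>q. if q = p then 1 else 0 :: real)" for p
  have U: "U p \<in> carrier_mat n n" for p by (simp add: U_def)
  have nonneg: "0 \<le> \<nu> A" and zero: "\<nu> A = 0 \<longleftrightarrow> A = 0\<^sub>m n n" and scale: "\<nu> (c \<cdot>\<^sub>m A) = \<bar>c\<bar> * \<nu> A"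
    if "A \<in> carrier_mat n n" for A c
    using assms that unfolding matrix_norm_def by auto
  have tri: "\<nu> (A + B) \<le> \<nu> A + \<nu> B" if "A \<in> carrier_mat n n" "B \<in> carrier_mat n n" for A B
    using assms that unfolding matrix_norm_def by blast
  have part: "\<nu> (mat n n (\<lambda>p. if p \<in> S then a p else 0)) \<le> (\<Sum>p\<in>S. \<bar>a p\<bar> * \<nu> (U p))"
    if "finite S" for S and a :: "nat \<times> nat \<Rightarrow> real"
    using that
  proof induction
    case empty
    have "mat n n (\<lambda>p. 0) = (0\<^sub>m n n :: real mat)" by (intro eq_matI) auto
    then show ?case using zero[of "0\<^sub>m n n"] by simp
  next
    case (insert p S)
    have "mat n n (\<lambda>q. if q \<in> insert p S then a q else 0)
        = a p \<cdot>\<^sub>m U p + mat n n (\<lambda>q. if q \<in> S then a q else 0)"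
      using insert.hyps by (intro eq_matI) (auto simp: U_def)
    also have "\<nu> \<dots> \<le> \<bar>a p\<bar> * \<nu> (U p) + \<nu> (mat n n (\<lambda>q. if q \<in> S then a q else 0))"
      using tri[OF smult_carrier_mat[OF U] mat_carrier] unfolding scale[OF U] .
    finally show ?case using insert by simp
  qed
  define C where "C = (\<Sum>p\<in>{..<n}\<times>{..<n}. \<nu> (U p))"
  have "\<nu> A \<le> C * b"
    if A: "A \<in> carrier_mat n n" and b: "\<forall>i<n. \<forall>j<n. \<bar>A $$ (i, j)\<bar> \<le> b" for A b
  proof -
    have "A = mat n n (\<lambda>p. if p \<in> {..<n}\<times>{..<n} then A $$ p else 0)"
      using A by (intro eq_matI) auto
    then have "\<nu> A = \<nu> (mat n n (\<lambda>p. if p \<in> {..<n}\<times>{..<n} then A $$ p else 0))"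
      by (rule arg_cong)
    also have "\<dots> \<le> (\<Sum>p\<in>{..<n}\<times>{..<n}. \<bar>A $$ p\<bar> * \<nu> (U p))"
      by (rule part) simp
    also have "\<dots> \<le> (\<Sum>p\<in>{..<n}\<times>{..<n}. b * \<nu> (U p))"
      using b nonneg[OF U] by (intro sum_mono mult_right_mono) auto
    finally show ?thesis by (simp add: C_def sum_distrib_left mult.commute)
  qed
  moreover have "C \<ge> 0" unfolding C_def using nonneg[OF U] by (intro sum_nonneg)
  ultimately show ?thesis by blast
qed

lemma limsup_root_le:
  fixes f :: "nat \<Rightarrow> real"
  assumes s: "0 \<le> s" and bd: "\<And>r. s < r \<Longrightarrow> \<exists>C. \<forall>\<^sub>F k in sequentially. f k \<le> C * r ^ k"
  shows "limsup (\<lambda>k. ereal (root k (f k))) \<le> ereal s"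
proof (rule ereal_le_epsilon2)
  fix d :: real assume d: "0 < d"
  define r where "r = s + d"
  have r: "r > 0" "s < r" using s d by (auto simp: r_def)
  obtain C where C: "\<forall>\<^sub>F k in sequentially. f k \<le> C * r ^ k" using bd[OF r(2)] by blast
  \<comment> \<open>Positive, so that its k-th roots tend to 1 and the constant disappears from the
    limit.\<close>
  define D where "D = max C 1"
  have D: "D > 0" by (simp add: D_def)
  \<comment> \<open>The index 0 is excluded because \<open>root 0\<close> is the default value
    0.\<close>
  have "\<forall>\<^sub>F k in sequentially. ereal (root k (f k)) \<le> ereal (root k D * r)"
    using C eventually_gt_at_top[of 0]
  proof eventually_elim
    case (elim k)
    have "C * r ^ k \<le> D * r ^ k"
      using r(1) by (intro mult_right_mono) (auto simp: D_def)
    with elim(1) have "f k \<le> D * r ^ k" by linarith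
    then have "root k (f k) \<le> root k (D * r ^ k)" using elim by simp
    also have "\<dots> = root k D * r" using elim r by (simp add: real_root_mult real_root_power_cancel)
    finally show ?case by simp
  qed
  then have "limsup (\<lambda>k. ereal (root k (f k))) \<le> limsup (\<lambda>k. ereal (root k D * r))"
    by (rule Limsup_mono)
  also have "(\<lambda>k. ereal (root k D * r)) \<longlonglongrightarrow> ereal (1 * r)"
    using LIMSEQ_root_const[OF D] by (intro tendsto_intros) auto
  then have "limsup (\<lambda>k. ereal (root k D * r)) = ereal r"
    by (simp add: lim_imp_Limsup)
  finally show "limsup (\<lambda>k. ereal (root k (f k))) \<le> ereal s + ereal d" by (simp add: r_def)
qed

subsection \<open>The error of the fixed-point iteration\<close>

lemma mat_entries_bounded:
  fixes A :: "'a::real_normed_vector mat"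
  shows "\<exists>b\<ge>0. \<forall>i<n. \<forall>j<n. norm (A $$ (i, j)) \<le> b"
proof (intro exI[of _ "\<Sum>p\<in>{..<n}\<times>{..<n}. norm (A $$ p)"] conjI allI impI)
  fix i j assume "i < n" "j < n"
  then show "norm (A $$ (i, j)) \<le> (\<Sum>p\<in>{..<n}\<times>{..<n}. norm (A $$ p))"
    by (intro member_le_sum) auto
qed (auto intro: sum_nonneg)

lemma mult_mat3_sum:
  fixes A B C :: "'a::comm_semiring_0 mat"
  assumes "A \<in> carrier_mat n n" "B \<in> carrier_mat n n" "C \<in> carrier_mat n n" "i < n" "j < n"
  shows "(A * B * C) $$ (i, j) = (\<Sum>l<n. \<Sum>m<n. A $$ (i, l) * B $$ (l, m) * C $$ (m, j))"
proof -
  have "(A * B * C) $$ (i, j) = (\<Sum>m<n. (\<Sum>l<n. A $$ (i, l) * B $$ (l, m)) * C $$ (m, j))"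
    using assms mult_mat_sum[of "A * B" n n C n i j] mult_mat_sum[OF assms(1,2,4)] by simp
  also have "\<dots> = (\<Sum>l<n. \<Sum>m<n. A $$ (i, l) * B $$ (l, m) * C $$ (m, j))"
    unfolding sum_distrib_right by (rule sum.swap)
  finally show ?thesis .
qed

lemma pow_mat_2:
  fixes A :: "'a::semiring_1 mat"
  assumes "A \<in> carrier_mat n n"
  shows "A ^\<^sub>m 2 = A * A"
  using assms by (simp add: numeral_2_eq_2)

lemma quad_step_carrier:
  assumes "X \<in> carrier_mat n n" "N \<in> carrier_mat n n"
  shows "(1/2 :: real) \<cdot>\<^sub>m (X ^\<^sub>m 2 + N) \<in> carrier_mat n n"
  using assms by (simp add: pow_mat_2)

lemma quad_step_index:
  assumes "X \<in> carrier_mat n n" "N \<in> carrier_mat n n" "i < n" "j < n"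
  shows "((1/2 :: real) \<cdot>\<^sub>m (X ^\<^sub>m 2 + N)) $$ (i, j)
    = ((\<Sum>l<n. X $$ (i, l) * X $$ (l, j)) + N $$ (i, j)) / 2"
  using assms mult_mat_sum[OF assms(1,1,3,4)] by (simp add: pow_mat_2 del: index_mult_mat(1))

text \<open>Since N - 2 G = - G^2, twice the new error is X^2 - G^2. Expanding X = G + D keeps both
  mixed products, because D and G need not commute.\<close>

lemma quad_error_step:
  fixes G N X :: "real mat"
  assumes G: "G \<in> carrier_mat n n" and N: "N = 2 \<cdot>\<^sub>m G - G * G" and X: "X \<in> carrier_mat n n"
  defines "D \<equiv> map_mat complex_of_real (X - G)" and "H \<equiv> map_mat complex_of_real G"
  shows "map_mat complex_of_real ((1/2) \<cdot>\<^sub>m (X ^\<^sub>m 2 + N) - G) = (1/2) \<cdot>\<^sub>m (D * H + H * D + D * D)"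
proof (intro eq_matI)
  have c: "N \<in> carrier_mat n n" "D \<in> carrier_mat n n" "H \<in> carrier_mat n n"
    using quad_carrier[OF G] minus_carrier_mat[OF G] G N by (simp_all add: D_def H_def)
  fix i j assume "i < dim_row ((1/2) \<cdot>\<^sub>m (D * H + H * D + D * D))"
    "j < dim_col ((1/2) \<cdot>\<^sub>m (D * H + H * D + D * D))"
  then have ij: "i < n" "j < n" using c by auto
  have "N $$ (i, j) = 2 * G $$ (i, j) - (\<Sum>l<n. G $$ (i, l) * G $$ (l, j))"
    using mult_mat_sum[OF G G ij] G ij by (simp add: N)
  then have "((1/2) \<cdot>\<^sub>m (X ^\<^sub>m 2 + N) - G) $$ (i, j)
      = ((\<Sum>l<n. X $$ (i, l) * X $$ (l, j)) - (\<Sum>l<n. G $$ (i, l) * G $$ (l, j))) / 2"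
    using quad_step_index[OF X c(1) ij] G ij by (simp add: field_simps)
  also have "\<dots> = (\<Sum>l<n. (X - G) $$ (i, l) * G $$ (l, j) + G $$ (i, l) * (X - G) $$ (l, j)
      + (X - G) $$ (i, l) * (X - G) $$ (l, j)) / 2"
    unfolding sum_subtractf[symmetric] using X G ij
    by (intro arg_cong[of _ _ "\<lambda>x. x / 2"] sum.cong refl) (simp add: algebra_simps)
  finally have "complex_of_real (((1/2) \<cdot>\<^sub>m (X ^\<^sub>m 2 + N) - G) $$ (i, j)) =
      complex_of_real ((\<Sum>l<n. (X - G) $$ (i, l) * G $$ (l, j) + G $$ (i, l) * (X - G) $$ (l, j)
      + (X - G) $$ (i, l) * (X - G) $$ (l, j)) / 2)"
    by (rule arg_cong)
  then show "map_mat complex_of_real ((1/2) \<cdot>\<^sub>m (X ^\<^sub>m 2 + N) - G) $$ (i, j)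
      = ((1/2) \<cdot>\<^sub>m (D * H + H * D + D * D)) $$ (i, j)"
    using ij G X c mult_mat_sum[OF c(2,3) ij] mult_mat_sum[OF c(3,2) ij] mult_mat_sum[OF c(2,2) ij]
    by (simp add: D_def H_def sum.distrib del: index_mult_mat(1) index_minus_mat(1))
qed (use G X N in \<open>auto simp: D_def H_def\<close>)

text \<open>The intertwining relations \<open>H * P1 = P1 * T1\<close> and
  \<open>Q2 * H = T2 * Q2\<close> make each linear term triangular on its own side. For the square,
  \<open>P1 * Q1\<close> and \<open>P2 * Q2\<close> are inserted between the factors, which leaves
  \<open>Q1 * P2\<close> in the middle.\<close>

lemma conj_error_step:
  fixes D :: "'a::field mat"
  assumes c: "D \<in> carrier_mat n n" "T1 \<in> carrier_mat n n" "P1 \<in> carrier_mat n n" "Q1 \<in> carrier_mat n n"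
      "T2 \<in> carrier_mat n n" "P2 \<in> carrier_mat n n" "Q2 \<in> carrier_mat n n"
    and inv: "P1 * Q1 = 1\<^sub>m n" "Q1 * P1 = 1\<^sub>m n" "P2 * Q2 = 1\<^sub>m n" "Q2 * P2 = 1\<^sub>m n"
    and H: "H = P1 * T1 * Q1" "H = P2 * T2 * Q2"
  shows "Q2 * (D * H + H * D + D * D) * P1
    = Q2 * D * P1 * T1 + T2 * (Q2 * D * P1) + (Q2 * D * P1) * (Q1 * P2) * (Q2 * D * P1)"
proof -
  note assoc = assoc_mult_mat[of _ n n _ n _ n]
  have Hc: "H \<in> carrier_mat n n" using H c by simp
  have "H * P1 = P1 * T1 * (Q1 * P1)" unfolding H(1) using c by (simp add: assoc)
  then have HP: "H * P1 = P1 * T1" using inv c by simp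
  have "Q2 * H = (Q2 * P2) * T2 * Q2" unfolding H(2) using c by (simp add: assoc)
  then have QH: "Q2 * H = T2 * Q2" using inv c by simp
  have "(Q2 * D * P1) * (Q1 * P2) * (Q2 * D * P1) = Q2 * D * (P1 * Q1) * (P2 * Q2) * D * P1"
    using c by (simp add: assoc)
  also have "\<dots> = Q2 * (D * D) * P1" using c by (simp add: inv assoc)
  finally have 3: "Q2 * (D * D) * P1 = (Q2 * D * P1) * (Q1 * P2) * (Q2 * D * P1)" ..
  have "Q2 * (D * H) * P1 = Q2 * D * (H * P1)" using c Hc by (simp add: assoc)
  then have 1: "Q2 * (D * H) * P1 = Q2 * D * P1 * T1" unfolding HP using c by (simp add: assoc)
  have "Q2 * (H * D) * P1 = (Q2 * H) * D * P1" using c Hc by (simp add: assoc)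
  then have 2: "Q2 * (H * D) * P1 = T2 * (Q2 * D * P1)" unfolding QH using c by (simp add: assoc)
  have "Q2 * (D * H + H * D + D * D) * P1 = Q2 * (D * H) * P1 + Q2 * (H * D) * P1 + Q2 * (D * D) * P1"
    using c Hc by (simp add: mult_add_distrib_mat[of _ n n _ n] add_mult_distrib_mat[of _ n n _ _ n])
  then show ?thesis unfolding 1 2 3 .
qed

text \<open>The triangular recursion is applied to \<open>Q2 * D * P1\<close>; since both
  transformations are fixed, going back to the error itself changes bounds only by a
  constant.\<close>

lemma root_rate_le_of_triangularizations:
  fixes G N :: "real mat" and X :: "nat \<Rightarrow> real mat"
  assumes G: "G \<in> carrier_mat n n" and N: "N = 2 \<cdot>\<^sub>m G - G * G"
    and X: "\<And>k. X k \<in> carrier_mat n n" and X_Suc: "\<And>k. X (Suc k) = (1/2) \<cdot>\<^sub>m (X k ^\<^sub>m 2 + N)"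
    and lim: "mat_tendsto n X G"
    and c: "T1 \<in> carrier_mat n n" "P1 \<in> carrier_mat n n" "Q1 \<in> carrier_mat n n"
      "T2 \<in> carrier_mat n n" "P2 \<in> carrier_mat n n" "Q2 \<in> carrier_mat n n"
    and inv: "P1 * Q1 = 1\<^sub>m n" "Q1 * P1 = 1\<^sub>m n" "P2 * Q2 = 1\<^sub>m n" "Q2 * P2 = 1\<^sub>m n"
    and H: "map_mat complex_of_real G = P1 * T1 * Q1" "map_mat complex_of_real G = P2 * T2 * Q2"
    and ut: "upper_triangular T1" "upper_triangular T2"
    and s: "0 \<le> s"
    and diag: "\<And>k i j. i < n \<Longrightarrow> j < n \<Longrightarrow>
      (Q2 * map_mat complex_of_real (X k - G) * P1) $$ (i, j) = 0 \<or> cmod (T1 $$ (j, j) + T2 $$ (i, i)) \<le> 2 * s"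
  shows "root_rate_le n X G s"
  unfolding root_rate_le_def
proof (intro allI impI limsup_root_le s)
  fix \<nu> r assume \<nu>: "matrix_norm n \<nu>" and r: "s < r"
  define D where "D k = map_mat complex_of_real (X k - G)" for k
  define F where "F k = Q2 * D k * P1" for k
  have Dc: "D k \<in> carrier_mat n n" for k using minus_carrier_mat[OF G] by (simp add: D_def)
  have Fc: "F k \<in> carrier_mat n n" for k unfolding F_def by (rule mult_carrier_mat[OF mult_carrier_mat[OF c(6) Dc] c(2)])
  define M where "M = Q1 * P2"
  have Mc: "M \<in> carrier_mat n n" using c by (simp add: M_def)
  have FS: "F (Suc k) = (1/2) \<cdot>\<^sub>m (F k * T1 + T2 * F k + F k * M * F k)" for k
  proof -
    let ?H = "map_mat complex_of_real G"
    have "F (Suc k) = Q2 * ((1/2) \<cdot>\<^sub>m (D k * ?H + ?H * D k + D k * D k)) * P1"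
      unfolding F_def D_def X_Suc by (subst quad_error_step[OF G N X]) (rule refl)
    also have "\<dots> = (1/2) \<cdot>\<^sub>m (Q2 * (D k * ?H + ?H * D k + D k * D k) * P1)"
      using c Dc[of k] G by (simp add: mult_smult_distrib[of _ n n _ n] mult_smult_assoc_mat[of _ n n _ n])
    finally show ?thesis
      unfolding conj_error_step[OF Dc c inv H] F_def M_def .
  qed
  have rec: "F (Suc k) $$ (i, j) = ((\<Sum>l<n. F k $$ (i, l) * T1 $$ (l, j)) + (\<Sum>l<n. T2 $$ (i, l) * F k $$ (l, j))
      + (\<Sum>l<n. \<Sum>m<n. F k $$ (i, l) * M $$ (l, m) * F k $$ (m, j))) / 2" if "i < n" "j < n" for k i j
    unfolding FS using that c Fc[of k] Mc
      mult_mat_sum[OF Fc[of k] c(1) that] mult_mat_sum[OF c(4) Fc[of k] that] mult_mat3_sum[OF Fc[of k] Mc Fc[of k] that]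
    by (simp del: index_mult_mat(1))
  have Flim: "(\<lambda>k. F k $$ (i, j)) \<longlonglongrightarrow> 0" if ij: "i < n" "j < n" for i j
  proof -
    have Dlim: "(\<lambda>k. D k $$ (l, m)) \<longlonglongrightarrow> 0" if "l < n" "m < n" for l m
    proof -
      have "(\<lambda>k. complex_of_real (X k $$ (l, m) - G $$ (l, m))) \<longlonglongrightarrow> complex_of_real (G $$ (l, m) - G $$ (l, m))"
        using lim that unfolding mat_tendsto_def by (intro tendsto_intros) auto
      then show ?thesis using G X that by (simp add: D_def)
    qed
    have "(\<lambda>k. F k $$ (i, j)) = (\<lambda>k. \<Sum>l<n. \<Sum>m<n. Q2 $$ (i, l) * D k $$ (l, m) * P1 $$ (m, j))"
      unfolding F_def using mult_mat3_sum[OF c(6) Dc c(2) ij] by simp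
    also have "\<dots> \<longlonglongrightarrow> (\<Sum>l<n. \<Sum>m<n. Q2 $$ (i, l) * 0 * P1 $$ (m, j))"
      using Dlim by (intro tendsto_intros) auto
    finally show ?thesis by simp
  qed
  have "\<exists>C. \<forall>\<^sub>F k in sequentially. \<forall>i<n. \<forall>j<n. cmod (F k $$ (i, j)) \<le> C * r ^ k"
    by (rule triangular_recursion_rate[of n "\<lambda>k i j. F k $$ (i, j)" "\<lambda>i j. T1 $$ (i, j)" "\<lambda>i j. T2 $$ (i, j)"
        "\<lambda>i j. M $$ (i, j)", OF rec _ _ Flim diag[folded D_def, folded F_def] s r])
      (use ut c in \<open>auto elim: upper_triangularD\<close>)
  then obtain C where C: "\<forall>\<^sub>F k in sequentially. \<forall>i<n. \<forall>j<n. cmod (F k $$ (i, j)) \<le> C * r ^ k"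
    by blast
  obtain p where p: "p \<ge> 0" "\<And>i j. i < n \<Longrightarrow> j < n \<Longrightarrow> cmod (P2 $$ (i, j)) \<le> p"
    using mat_entries_bounded[where 'a = complex] by metis
  obtain q where q: "q \<ge> 0" "\<And>i j. i < n \<Longrightarrow> j < n \<Longrightarrow> cmod (Q1 $$ (i, j)) \<le> q"
    using mat_entries_bounded[where 'a = complex] by metis
  obtain C' where C': "\<And>A b. A \<in> carrier_mat n n \<Longrightarrow> b \<ge> 0 \<Longrightarrow> (\<And>i j. i < n \<Longrightarrow> j < n \<Longrightarrow> \<bar>A $$ (i, j)\<bar> \<le> b) \<Longrightarrow> \<nu> A \<le> C' * b"
    using matrix_norm_entry_bound[OF \<nu>] by metis
  \<comment> \<open>Each entry of \<open>P2 * F k * Q1\<close> is a sum of \<open>n * n\<close>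
    products. Replacing \<open>C\<close> by \<open>max C 0\<close> makes the bound
    nonnegative.\<close>
  define K where "K = real n * (real n * (p * max C 0 * q))"
  have K: "K \<ge> 0" using p q by (simp add: K_def)
  have "\<forall>\<^sub>F k in sequentially. \<nu> (X k - G) \<le> C' * K * r ^ k"
    using C
  proof eventually_elim
    case (elim k)
    have DF: "D k = P2 * F k * Q1"
    proof -
      have "P2 * F k * Q1 = (P2 * Q2) * D k * (P1 * Q1)"
        unfolding F_def using c Dc[of k] by (simp add: assoc_mult_mat[of _ n n _ n _ n])
      then show ?thesis unfolding inv using Dc[of k] by simp
    qed
    have "\<bar>(X k - G) $$ (i, j)\<bar> \<le> K * r ^ k" if ij: "i < n" "j < n" for i j
    proof -
      have F: "cmod (F k $$ (l, m)) \<le> max C 0 * r ^ k" if "l < n" "m < n" for l m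
      proof -
        have "C * r ^ k \<le> max C 0 * r ^ k" using s r by (intro mult_right_mono) auto
        then show ?thesis using elim that by (meson order.trans)
      qed
      have "\<bar>(X k - G) $$ (i, j)\<bar> = cmod (D k $$ (i, j))"
        using ij G by (simp add: D_def norm_of_real[symmetric] del: norm_of_real of_real_diff)
      also have "D k $$ (i, j) = (\<Sum>l<n. \<Sum>m<n. P2 $$ (i, l) * F k $$ (l, m) * Q1 $$ (m, j))"
        unfolding DF by (rule mult_mat3_sum[OF c(5) Fc c(3) ij])
      also have "cmod \<dots> \<le> (\<Sum>l<n. \<Sum>m<n. p * (max C 0 * r ^ k) * q)"
        using p q F ij s r
        by (intro order.trans[OF norm_sum] sum_mono) (auto simp: norm_mult intro!: mult_mono)
      also have "\<dots> = K * r ^ k" by (simp add: K_def mult_ac)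
      finally show ?thesis .
    qed
    then show ?case
      using C'[OF minus_carrier_mat[OF G], of "K * r ^ k" "X k"] K s r by (auto simp: mult.assoc)
  qed
  then show "\<exists>C. \<forall>\<^sub>F k in sequentially. \<nu> (X k - G) \<le> C * r ^ k" by blast
qed

section \<open>Vectors fixed by all iterates, and the kernel of the error\<close>

lemma quad_step_fixed_vec:
  fixes X N :: "real mat"
  assumes X: "X \<in> carrier_mat n n" and N: "N \<in> carrier_mat n n" and w: "w \<in> carrier_vec n"
    and Xw: "X *\<^sub>v w = w" and Nw: "N *\<^sub>v w = w"
  shows "((1/2) \<cdot>\<^sub>m (X ^\<^sub>m 2 + N)) *\<^sub>v w = w"
proof -
  have "(X * X + N) *\<^sub>v w = (X * X) *\<^sub>v w + N *\<^sub>v w"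
    using X N w by (intro add_mult_distrib_mat_vec[of _ n n]) auto
  also have "(X * X) *\<^sub>v w = w"
    using assoc_mult_mat_vec[OF X X w] Xw by simp
  finally have "(X * X + N) *\<^sub>v w = w + w" using Nw by simp
  moreover have "((1/2) \<cdot>\<^sub>m (X * X + N)) *\<^sub>v w = (1/2) \<cdot>\<^sub>v ((X * X + N) *\<^sub>v w)"
    using X N w by (intro eq_vecI) auto
  ultimately show ?thesis using w X by (intro eq_vecI) (simp_all add: pow_mat_2)
qed

text \<open>The transposed iterates follow the same iteration with the transpose of
  \<open>N\<close>, so every statement about v as a left vector reduces to one about a right
  vector.\<close>

lemma transpose_quad_step:
  fixes X N :: "real mat"
  assumes X: "X \<in> carrier_mat n n" and N: "N \<in> carrier_mat n n"
  shows "transpose_mat ((1/2) \<cdot>\<^sub>m (X ^\<^sub>m 2 + N))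
    = (1/2) \<cdot>\<^sub>m (transpose_mat X ^\<^sub>m 2 + transpose_mat N)"
proof -
  have "transpose_mat X * transpose_mat X = transpose_mat (X * X)"
    using transpose_mult[OF X X] by simp
  moreover have "transpose_mat X \<in> carrier_mat n n" using X by simp
  ultimately show ?thesis
    using X N by (intro eq_matI) (simp_all add: pow_mat_2[of _ n])
qed

text \<open>In \<open>H * P = P * T\<close> the first column of \<open>T\<close> contributes only
  its diagonal entry.\<close>

lemma schur_first_column:
  fixes H :: "'a::idom mat"
  assumes c: "T \<in> carrier_mat n n" "P \<in> carrier_mat n n" "Q \<in> carrier_mat n n"
    and QP: "Q * P = 1\<^sub>m n" and H: "H = P * T * Q" and ut: "upper_triangular T" and n: "0 < n"
  shows "H *\<^sub>v col P 0 = T $$ (0, 0) \<cdot>\<^sub>v col P 0"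
proof (intro eq_vecI)
  have "H * P = P * T * (Q * P)" unfolding H using c by (simp add: assoc_mult_mat[of _ n n _ n _ n])
  then have HP: "H * P = P * T" using c by (simp add: QP)
  have Hc: "H \<in> carrier_mat n n" using H c by simp
  fix i assume "i < dim_vec (T $$ (0, 0) \<cdot>\<^sub>v col P 0)"
  then have i: "i < n" using c by simp
  have "(H *\<^sub>v col P 0) $ i = (H * P) $$ (i, 0)" using Hc c i n by simp
  also have "\<dots> = (\<Sum>l<n. P $$ (i, l) * T $$ (l, 0))"
    unfolding HP by (rule mult_mat_sum[OF c(2,1) i n])
  also have "\<dots> = (\<Sum>l<n. if l = 0 then P $$ (i, 0) * T $$ (0, 0) else 0)"
    using c upper_triangularD[OF ut, of 0] by (intro sum.cong refl) auto
  also have "\<dots> = (T $$ (0, 0) \<cdot>\<^sub>v col P 0) $ i" using c i n by simp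
  finally show "(H *\<^sub>v col P 0) $ i = (T $$ (0, 0) \<cdot>\<^sub>v col P 0) $ i" .
qed (use H c in simp)

text \<open>In \<open>Q * H = T * Q\<close> the last row of \<open>T\<close> contributes only its
  diagonal entry.\<close>

lemma schur_last_row:
  fixes H :: "'a::idom mat"
  assumes c: "T \<in> carrier_mat n n" "P \<in> carrier_mat n n" "Q \<in> carrier_mat n n"
    and QP: "Q * P = 1\<^sub>m n" and H: "H = P * T * Q" and ut: "upper_triangular T" and p: "Suc p = n"
  shows "transpose_mat H *\<^sub>v row Q p = T $$ (p, p) \<cdot>\<^sub>v row Q p"
proof (intro eq_vecI)
  have "Q * H = (Q * P) * T * Q" unfolding H using c by (simp add: assoc_mult_mat[of _ n n _ n _ n])
  then have QH: "Q * H = T * Q" using c by (simp add: QP)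
  have Hc: "H \<in> carrier_mat n n" using H c by simp
  have pn: "p < n" using p by simp
  fix j assume "j < dim_vec (T $$ (p, p) \<cdot>\<^sub>v row Q p)"
  then have j: "j < n" using c by simp
  have "(transpose_mat H *\<^sub>v row Q p) $ j = (Q * H) $$ (p, j)"
    using Hc c j pn by (simp add: scalar_prod_def mult.commute)
  also have "\<dots> = (\<Sum>l<n. T $$ (p, l) * Q $$ (l, j))"
    unfolding QH by (rule mult_mat_sum[OF c(1,3) pn j])
  also have "\<dots> = (\<Sum>l<n. if l = p then T $$ (p, p) * Q $$ (p, j) else 0)"
    using c ut p by (intro sum.cong refl) (auto elim: upper_triangularD)
  also have "\<dots> = (T $$ (p, p) \<cdot>\<^sub>v row Q p) $ j" using c j pn by simp
  finally show "(transpose_mat H *\<^sub>v row Q p) $ j = (T $$ (p, p) \<cdot>\<^sub>v row Q p) $ j" .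
qed (use H c in simp)

text \<open>The entry is row \<open>i\<close> of \<open>Q\<close> times \<open>D\<close> times
  column \<open>j\<close> of \<open>P\<close>, so it suffices that \<open>D\<close> annihilates one
  of these two vectors from the matching side.\<close>

lemma error_conj_entry_zero:
  fixes Q D P :: "complex mat"
  assumes c: "Q \<in> carrier_mat n n" "D \<in> carrier_mat n n" "P \<in> carrier_mat n n" and ij: "i < n" "j < n"
  shows "D *\<^sub>v col P j = 0\<^sub>v n \<Longrightarrow> (Q * D * P) $$ (i, j) = 0"
    and "transpose_mat D *\<^sub>v row Q i = 0\<^sub>v n \<Longrightarrow> (Q * D * P) $$ (i, j) = 0"
proof -
  assume *: "D *\<^sub>v col P j = 0\<^sub>v n"
  have "(Q * D * P) $$ (i, j) = (Q * (D * P)) $$ (i, j)"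
    using c by (simp add: assoc_mult_mat[of _ n n _ n _ n])
  also have "\<dots> = (\<Sum>l<n. Q $$ (i, l) * (D * P) $$ (l, j))"
    by (rule mult_mat_sum[OF c(1) mult_carrier_mat[OF c(2,3)] ij])
  also have "\<dots> = 0"
  proof (intro sum.neutral ballI)
    fix l assume l: "l \<in> {..<n}"
    then have "(D * P) $$ (l, j) = (D *\<^sub>v col P j) $ l" using c ij by simp
    then show "Q $$ (i, l) * (D * P) $$ (l, j) = 0" using * l by simp
  qed
  finally show "(Q * D * P) $$ (i, j) = 0" .
next
  assume *: "transpose_mat D *\<^sub>v row Q i = 0\<^sub>v n"
  have "(Q * D * P) $$ (i, j) = (\<Sum>l<n. (Q * D) $$ (i, l) * P $$ (l, j))"
    by (rule mult_mat_sum[OF mult_carrier_mat[OF c(1,2)] c(3) ij])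
  also have "\<dots> = 0"
  proof (intro sum.neutral ballI)
    fix l assume l: "l \<in> {..<n}"
    then have "(Q * D) $$ (i, l) = (transpose_mat D *\<^sub>v row Q i) $ l"
      using c ij by (simp add: scalar_prod_def mult.commute)
    then show "(Q * D) $$ (i, l) * P $$ (l, j) = 0" using * l by simp
  qed
  finally show "(Q * D * P) $$ (i, j) = 0" .
qed

text \<open>A complex vector fixed by \<open>G\<close> is fixed by \<open>N\<close>, hence a
  multiple of \<open>u\<close>, and \<open>X\<close> and \<open>G\<close> agree on \<open>u\<close>.
  The statement concerns arbitrary matrices so that it also serves the transposed problem with v in
  place of u.\<close>

lemma fixed_vec_in_error_kernel:
  fixes G N X :: "real mat"
  assumes G: "G \<in> carrier_mat n n" and N: "N = 2 \<cdot>\<^sub>m G - G * G"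
    and simple: "simple_eigenvalue N 1"
    and u: "u \<in> carrier_vec n" "N *\<^sub>v u = u" "u \<noteq> 0\<^sub>v n"
    and X: "X \<in> carrier_mat n n" "X *\<^sub>v u = u"
    and x: "x \<in> carrier_vec n" "map_mat complex_of_real G *\<^sub>v x = x"
  shows "map_mat complex_of_real (X - G) *\<^sub>v x = 0\<^sub>v n"
proof -
  have Nc: "N \<in> carrier_mat n n" using quad_carrier[OF G] N by simp
  let ?G = "map_mat complex_of_real G"
  have GG: "map_mat complex_of_real (G * G) = ?G * ?G"
    by (rule of_real_hom.mat_hom_mult[OF G G])
  have "map_mat complex_of_real N = 2 \<cdot>\<^sub>m ?G - ?G * ?G"
    unfolding N GG[symmetric] using G by (intro eq_matI) (simp_all del: index_mult_mat(1))
  then have "map_mat complex_of_real N *\<^sub>v x = complex_of_real 1 \<cdot>\<^sub>v x"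
    using quad_fixed_vec[of ?G n _ x] G x by simp
  then obtain a where a: "x = a \<cdot>\<^sub>v map_vec complex_of_real u"
    using simple_eigenspace_real[OF Nc simple u(1) _ u(3) x(1)] u(2) by auto
  have Gu: "G *\<^sub>v u = u" by (rule quad_simple_fixed[OF G N simple u])
  have "(X - G) *\<^sub>v u = X *\<^sub>v u - G *\<^sub>v u"
    by (rule minus_mult_distrib_mat_vec[OF X(1) G u(1)])
  then have 0: "(X - G) *\<^sub>v u = 0\<^sub>v n" using Gu X u by simp
  have XG: "X - G \<in> carrier_mat n n" by (rule minus_carrier_mat[OF G])
  have "map_mat complex_of_real (X - G) *\<^sub>v x
      = a \<cdot>\<^sub>v (map_mat complex_of_real (X - G) *\<^sub>v map_vec complex_of_real u)"
    unfolding a using XG u(1) by (intro mult_mat_vec[of _ n n]) simp_all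
  also have "\<dots> = a \<cdot>\<^sub>v map_vec complex_of_real ((X - G) *\<^sub>v u)"
    using of_real_hom.mult_mat_vec_hom[OF XG u(1)] by metis
  also have "\<dots> = 0\<^sub>v n" unfolding 0 by (intro eq_vecI) simp_all
  finally show ?thesis .
qed

lemma quad_transpose:
  fixes G N :: "'a::comm_ring_1 mat"
  assumes G: "G \<in> carrier_mat n n" and N: "N = 2 \<cdot>\<^sub>m G - G * G"
  shows "transpose_mat N = 2 \<cdot>\<^sub>m transpose_mat G - transpose_mat G * transpose_mat G"
  unfolding N transpose_mult[OF G G, symmetric]
  using G by (intro eq_matI) (simp_all del: index_mult_mat(1))

lemma simple_eigenvalue_transpose:
  assumes A: "A \<in> carrier_mat n n" and simple: "simple_eigenvalue A x"
  shows "simple_eigenvalue (transpose_mat A) x"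
proof -
  have "transpose_mat A \<in> carrier_mat n n" using A by simp
  then show ?thesis
    using simple unfolding simple_eigenvalue_def
    by (simp add: eigenvalue_root_char_poly[OF A] eigenvalue_root_char_poly char_poly_transpose_mat[OF A])
qed

subsection \<open>Convergence to the minimal solution\<close>

lemma nonneg_mat_iff:
  "nonneg_mat n A \<longleftrightarrow> A \<in> carrier_mat n n \<and> (\<forall>i<n. \<forall>j<n. 0 \<le> A $$ (i, j))"
  unfolding nonneg_mat_def less_eq_mat_def by (rule conj_cong[OF refl]) simp

text \<open>After scaling by the diagonal matrix of \<open>u\<close> this is the usual
  row-substochastic property. It is written with entries and sums so that limits can be taken
  termwise.\<close>

definition substochastic :: "nat \<Rightarrow> real vec \<Rightarrow> real mat \<Rightarrow> bool" where
  "substochastic n u X \<longleftrightarrow> X \<in> carrier_mat n n \<and> (\<forall>i<n. \<forall>j<n. 0 \<le> X $$ (i, j)) \<and>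
     (\<forall>i<n. (\<Sum>j<n. X $$ (i, j) * u $ j) \<le> u $ i)"

locale singular_quadratic =
  fixes n :: nat and N :: "real mat" and u :: "real vec"
  assumes n: "n \<ge> 2" and N: "nonneg_mat n N" and u: "pos_vec n u"
    and Nu: "N *\<^sub>v u = u" and simple: "simple_eigenvalue N 1"
begin

lemma N_carrier: "N \<in> carrier_mat n n"
  and N_nonneg: "i < n \<Longrightarrow> j < n \<Longrightarrow> 0 \<le> N $$ (i, j)"
  using N by (simp_all add: nonneg_mat_iff)

lemma u_carrier: "u \<in> carrier_vec n"
  and u_pos: "i < n \<Longrightarrow> 0 < u $ i"
  using u by (auto simp: pos_vec_def)

lemma u_nonzero: "u \<noteq> 0\<^sub>v n"
  using u_pos[of 0] n by auto

lemma Nu_sum: "i < n \<Longrightarrow> (\<Sum>j<n. N $$ (i, j) * u $ j) = u $ i"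
  using mult_mat_vec_sum[OF N_carrier u_carrier] Nu by metis

definition step :: "real mat \<Rightarrow> real mat" where
  "step X = (1/2) \<cdot>\<^sub>m (X ^\<^sub>m 2 + N)"

lemma step_carrier: "X \<in> carrier_mat n n \<Longrightarrow> step X \<in> carrier_mat n n"
  unfolding step_def by (rule quad_step_carrier[OF _ N_carrier])

lemma step_index:
  "X \<in> carrier_mat n n \<Longrightarrow> i < n \<Longrightarrow> j < n \<Longrightarrow>
    step X $$ (i, j) = ((\<Sum>l<n. X $$ (i, l) * X $$ (l, j)) + N $$ (i, j)) / 2"
  unfolding step_def by (rule quad_step_index[OF _ N_carrier])

text \<open>From X >= 0 and X u <= u follows X (X u) <= X u <= u; averaging with N u = u preserves
  the bound.\<close>

lemma substochastic_step:
  assumes X: "substochastic n u X"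
  shows "substochastic n u (step X)"
proof -
  have Xc: "X \<in> carrier_mat n n" and X0: "\<And>i j. i < n \<Longrightarrow> j < n \<Longrightarrow> 0 \<le> X $$ (i, j)"
    and Xu: "\<And>i. i < n \<Longrightarrow> (\<Sum>j<n. X $$ (i, j) * u $ j) \<le> u $ i"
    using X by (auto simp: substochastic_def)
  have "0 \<le> step X $$ (i, j)" if "i < n" "j < n" for i j
    unfolding step_index[OF Xc that] using N_nonneg[OF that] X0 that
    by (auto intro!: sum_nonneg add_nonneg_nonneg divide_nonneg_nonneg)
  moreover have "(\<Sum>j<n. step X $$ (i, j) * u $ j) \<le> u $ i" if i: "i < n" for i
  proof -
    have "(\<Sum>j<n. step X $$ (i, j) * u $ j)
        = ((\<Sum>j<n. \<Sum>l<n. X $$ (i, l) * X $$ (l, j) * u $ j) + (\<Sum>j<n. N $$ (i, j) * u $ j)) / 2"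
      by (simp add: step_index[OF Xc i] sum.distrib sum_divide_distrib sum_distrib_right
          distrib_right add_divide_distrib)
    also have "(\<Sum>j<n. \<Sum>l<n. X $$ (i, l) * X $$ (l, j) * u $ j)
        = (\<Sum>l<n. X $$ (i, l) * (\<Sum>j<n. X $$ (l, j) * u $ j))"
      by (subst sum.swap) (simp add: sum_distrib_left mult.assoc)
    also have "\<dots> \<le> (\<Sum>l<n. X $$ (i, l) * u $ l)"
      using Xu X0 i by (intro sum_mono mult_left_mono) auto
    finally show ?thesis using Xu[OF i] Nu_sum[OF i] by simp
  qed
  ultimately show ?thesis using step_carrier[OF Xc] by (simp add: substochastic_def)
qed

text \<open>Products are monotone on nonnegative factors: \<open>X\<close> is nonnegative, and
  \<open>Z\<close> inherits this by lying above it.\<close>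

lemma step_mono:
  assumes X: "substochastic n u X" and Z: "Z \<in> carrier_mat n n"
    and le: "\<And>i j. i < n \<Longrightarrow> j < n \<Longrightarrow> X $$ (i, j) \<le> Z $$ (i, j)" and ij: "i < n" "j < n"
  shows "step X $$ (i, j) \<le> step Z $$ (i, j)"
proof -
  have X0: "\<And>i j. i < n \<Longrightarrow> j < n \<Longrightarrow> 0 \<le> X $$ (i, j)" using X by (auto simp: substochastic_def)
  have "(\<Sum>l<n. X $$ (i, l) * X $$ (l, j)) \<le> (\<Sum>l<n. Z $$ (i, l) * Z $$ (l, j))"
    using X0 le ij order.trans[OF X0 le] by (intro sum_mono mult_mono) auto
  moreover have "X \<in> carrier_mat n n" using X by (simp add: substochastic_def)
  ultimately show ?thesis by (simp only: step_index[OF _ ij] Z) simp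
qed

section \<open>The iteration started at zero and its limit\<close>

definition Y :: "nat \<Rightarrow> real mat" where
  "Y k = (step ^^ k) (0\<^sub>m n n)"

lemma Y_simps: "Y 0 = 0\<^sub>m n n" "Y (Suc k) = step (Y k)"
  by (simp_all add: Y_def)

lemma substochastic_Y: "substochastic n u (Y k)"
proof (induction k)
  case 0
  show ?case using u_pos by (auto simp: Y_simps substochastic_def less_imp_le)
qed (simp add: Y_simps substochastic_step)

lemma Y_carrier: "Y k \<in> carrier_mat n n"
  and Y_nonneg: "i < n \<Longrightarrow> j < n \<Longrightarrow> 0 \<le> Y k $$ (i, j)"
  and Y_le: "i < n \<Longrightarrow> (\<Sum>j<n. Y k $$ (i, j) * u $ j) \<le> u $ i"
  using substochastic_Y by (auto simp: substochastic_def)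

text \<open>This serves twice: a constant sequence at a nonnegative solution yields minimality of
  the limit, and the given iteration yields the lower half of the sandwich for convergence.\<close>

lemma Y_least:
  assumes "\<And>k. X k \<in> carrier_mat n n" "\<And>k. X (Suc k) = step (X k)"
    and "\<And>i j. i < n \<Longrightarrow> j < n \<Longrightarrow> 0 \<le> X 0 $$ (i, j)"
  shows "i < n \<Longrightarrow> j < n \<Longrightarrow> Y k $$ (i, j) \<le> X k $$ (i, j)"
proof (induction k arbitrary: i j)
  case (Suc k)
  show ?case unfolding Y_simps assms(2)
    by (rule step_mono[OF substochastic_Y assms(1) Suc.IH Suc.prems])
qed (simp add: Y_simps assms)

lemma Y_incseq: "i < n \<Longrightarrow> j < n \<Longrightarrow> incseq (\<lambda>k. Y k $$ (i, j))"
proof (rule incseq_SucI)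
  fix k assume "i < n" "j < n"
  then show "Y k $$ (i, j) \<le> Y (Suc k) $$ (i, j)"
  proof (induction k arbitrary: i j)
    case 0
    then show ?case using Y_nonneg[of i j 1] by (simp add: Y_simps)
  next
    case (Suc k)
    show ?case unfolding Y_simps(2)[of "Suc k"] Y_simps(2)[of k]
      by (rule step_mono[OF substochastic_Y step_carrier[OF Y_carrier] _ Suc.prems])
        (use Suc.IH in \<open>simp add: Y_simps\<close>)
  qed
qed

lemma substochastic_entry_le:
  assumes "substochastic n u X" "i < n" "j < n"
  shows "X $$ (i, j) \<le> u $ i / u $ j"
proof -
  have "X $$ (i, j) * u $ j \<le> (\<Sum>j<n. X $$ (i, j) * u $ j)"
    using assms u_pos by (intro member_le_sum[of j "{..<n}" "\<lambda>j. X $$ (i, j) * u $ j"])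
      (auto simp: substochastic_def less_imp_le)
  also have "\<dots> \<le> u $ i" using assms by (simp add: substochastic_def)
  finally show ?thesis using u_pos[OF assms(3)] by (simp add: field_simps)
qed

text \<open>The limits exist because the entries of \<open>Y k\<close> increase and stay below
  \<open>u $ i / u $ j\<close>.\<close>

definition G :: "real mat" where
  "G = mat n n (\<lambda>p. lim (\<lambda>k. Y k $$ p))"

lemma G_carrier: "G \<in> carrier_mat n n"
  by (simp add: G_def)

lemma Y_tendsto: "i < n \<Longrightarrow> j < n \<Longrightarrow> (\<lambda>k. Y k $$ (i, j)) \<longlonglongrightarrow> G $$ (i, j)"
proof -
  assume ij: "i < n" "j < n"
  obtain L where "(\<lambda>k. Y k $$ (i, j)) \<longlonglongrightarrow> L"
    using incseq_convergent[OF Y_incseq[OF ij]] substochastic_entry_le[OF substochastic_Y ij] by metis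
  then show ?thesis using ij by (simp add: G_def limI)
qed

lemma G_nonneg: "i < n \<Longrightarrow> j < n \<Longrightarrow> 0 \<le> G $$ (i, j)"
  using LIMSEQ_le_const[OF Y_tendsto] Y_nonneg by blast

lemma Gu_le: "i < n \<Longrightarrow> (\<Sum>j<n. G $$ (i, j) * u $ j) \<le> u $ i"
  by (rule LIMSEQ_le_const2[where X = "\<lambda>k. \<Sum>j<n. Y k $$ (i, j) * u $ j"])
    (auto intro!: tendsto_intros Y_tendsto Y_le)

lemma step_G: "step G = G"
proof (intro eq_matI)
  fix i j assume "i < dim_row G" "j < dim_col G"
  then have ij: "i < n" "j < n" using G_carrier by auto
  have "(\<lambda>k. Y (Suc k) $$ (i, j)) \<longlonglongrightarrow> ((\<Sum>l<n. G $$ (i, l) * G $$ (l, j)) + N $$ (i, j)) / 2"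
    unfolding Y_simps step_index[OF Y_carrier ij] using ij by (intro tendsto_intros Y_tendsto) auto
  moreover have "(\<lambda>k. Y (Suc k) $$ (i, j)) \<longlonglongrightarrow> G $$ (i, j)"
    using Y_tendsto[OF ij] by (rule LIMSEQ_Suc)
  ultimately show "step G $$ (i, j) = G $$ (i, j)"
    unfolding step_index[OF G_carrier ij] by (rule LIMSEQ_unique)
qed (use G_carrier step_carrier[OF G_carrier] in auto)

lemma fixed_iff_quad_solution:
  assumes Z: "Z \<in> carrier_mat n n"
  shows "quad_solution n N Z \<longleftrightarrow> step Z = Z"
proof -
  have i1: "(Z ^\<^sub>m 2 - 2 \<cdot>\<^sub>m Z + N) $$ (i, j) = 2 * (step Z $$ (i, j) - Z $$ (i, j))" if "i < n" "j < n" for i j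
    unfolding step_index[OF Z that] using Z N_carrier that mult_mat_sum[OF Z Z that]
    by (simp add: pow_mat_2 del: index_mult_mat(1))
  have "Z ^\<^sub>m 2 - 2 \<cdot>\<^sub>m Z + N = 0\<^sub>m n n \<longleftrightarrow> (\<forall>i<n. \<forall>j<n. step Z $$ (i, j) = Z $$ (i, j))"
  proof
    assume "Z ^\<^sub>m 2 - 2 \<cdot>\<^sub>m Z + N = 0\<^sub>m n n"
    then show "\<forall>i<n. \<forall>j<n. step Z $$ (i, j) = Z $$ (i, j)" using i1 by auto
  next
    assume *: "\<forall>i<n. \<forall>j<n. step Z $$ (i, j) = Z $$ (i, j)"
    show "Z ^\<^sub>m 2 - 2 \<cdot>\<^sub>m Z + N = 0\<^sub>m n n"
    proof (intro eq_matI)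
      fix i j assume "i < dim_row (0\<^sub>m n n :: real mat)" "j < dim_col (0\<^sub>m n n :: real mat)"
      then show "(Z ^\<^sub>m 2 - 2 \<cdot>\<^sub>m Z + N) $$ (i, j) = 0\<^sub>m n n $$ (i, j)" using * i1[of i j] by simp
    qed (use N_carrier in auto)
  qed
  also have "\<dots> \<longleftrightarrow> step Z = Z"
    using Z step_carrier[OF Z] by (auto intro!: eq_matI)
  finally show ?thesis using Z by (simp add: quad_solution_def)
qed

lemma N_eq: "N = 2 \<cdot>\<^sub>m G - G * G"
proof (intro eq_matI)
  fix i j assume "i < dim_row (2 \<cdot>\<^sub>m G - G * G)" "j < dim_col (2 \<cdot>\<^sub>m G - G * G)"
  then have ij: "i < n" "j < n" using G_carrier by auto
  show "N $$ (i, j) = (2 \<cdot>\<^sub>m G - G * G) $$ (i, j)"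
    using step_index[OF G_carrier ij] mult_mat_sum[OF G_carrier G_carrier ij] G_carrier ij
    unfolding step_G by (simp del: index_mult_mat(1))
qed (use G_carrier N_carrier in auto)

lemma minimal_G: "minimal_nonneg_solution n N G"
  unfolding minimal_nonneg_solution_def
proof (intro conjI allI impI)
  show "quad_solution n N G" using fixed_iff_quad_solution[OF G_carrier] step_G by blast
  show "nonneg_mat n G" using G_carrier G_nonneg by (simp add: nonneg_mat_iff)
  fix Z assume Z: "quad_solution n N Z" "nonneg_mat n Z"
  have Zc: "Z \<in> carrier_mat n n" using Z(2) by (simp add: nonneg_mat_def)
  have "step Z = Z" using fixed_iff_quad_solution[OF Zc] Z(1) by blast
  then have "Y k $$ (i, j) \<le> Z $$ (i, j)" if "i < n" "j < n" for i j k
    using Y_least[of "\<lambda>_. Z"] Zc Z(2) that by (simp add: nonneg_mat_iff)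
  then have "G $$ (i, j) \<le> Z $$ (i, j)" if "i < n" "j < n" for i j
    using LIMSEQ_le_const2[OF Y_tendsto[OF that]] that by blast
  then show "G \<le> Z" using G_carrier Zc by (simp add: less_eq_mat_def)
qed

lemma Gu: "G *\<^sub>v u = u"
  by (rule quad_simple_fixed[OF G_carrier N_eq simple u_carrier Nu u_nonzero])

lemma convergence:
  assumes X0: "substochastic n u (X 0)" and X_Suc: "\<And>k. X (Suc k) = step (X k)"
  shows "mat_tendsto n X G"
  unfolding mat_tendsto_def
proof (intro allI impI)
  fix i j assume ij: "i < n" "j < n"
  have sX: "substochastic n u (X k)" for k
    by (induction k) (simp_all add: X0 X_Suc substochastic_step)
  have YX: "Y k $$ (i, j) \<le> X k $$ (i, j)" if "i < n" "j < n" for i j k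
    using Y_least[of X i j k] sX X_Suc that by (simp add: substochastic_def)
  \<comment> \<open>Bounds the entry of \<open>X k - Y k\<close> at (i, j): in a nonnegative matrix
    one term of the weighted row sum is at most the whole sum, and dividing by
    \<open>u $ j > 0\<close> isolates the entry.\<close>
  define d where "d k = (u $ i - (\<Sum>j<n. Y k $$ (i, j) * u $ j)) / u $ j" for k
  have "d \<longlonglongrightarrow> (u $ i - (\<Sum>j<n. G $$ (i, j) * u $ j)) / u $ j"
    unfolding d_def using ij u_pos[OF ij(2)] by (intro tendsto_intros Y_tendsto) auto
  also have "(\<Sum>j<n. G $$ (i, j) * u $ j) = u $ i"
    using mult_mat_vec_sum[OF G_carrier u_carrier ij(1)] Gu by simp
  finally have d0: "d \<longlonglongrightarrow> 0" by simp
  have up: "X k $$ (i, j) \<le> Y k $$ (i, j) + d k" for k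
  proof -
    have "(X k $$ (i, j) - Y k $$ (i, j)) * u $ j \<le> (\<Sum>j<n. (X k $$ (i, j) - Y k $$ (i, j)) * u $ j)"
      using ij YX u_pos
      by (intro member_le_sum[of j "{..<n}" "\<lambda>j. (X k $$ (i, j) - Y k $$ (i, j)) * u $ j"])
        (auto intro!: mult_nonneg_nonneg simp: less_imp_le)
    also have "\<dots> = (\<Sum>j<n. X k $$ (i, j) * u $ j) - (\<Sum>j<n. Y k $$ (i, j) * u $ j)"
      by (simp add: left_diff_distrib sum_subtractf)
    also have "\<dots> \<le> u $ i - (\<Sum>j<n. Y k $$ (i, j) * u $ j)"
      using sX[of k] ij by (simp add: substochastic_def)
    finally show ?thesis using u_pos[OF ij(2)] by (simp add: d_def field_simps)
  qed
  have lim: "(\<lambda>k. Y k $$ (i, j) + d k) \<longlonglongrightarrow> G $$ (i, j)"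
    using tendsto_add[OF Y_tendsto[OF ij] d0] by simp
  show "(\<lambda>k. X k $$ (i, j)) \<longlonglongrightarrow> G $$ (i, j)"
    by (rule tendsto_sandwich[OF _ _ Y_tendsto[OF ij] lim]) (simp_all add: YX[OF ij] up)
qed

end

subsection \<open>The spectrum of the minimal solution\<close>

lemma prod_linear_upt:
  fixes lam :: "nat \<Rightarrow> 'a::comm_ring_1"
  shows "(\<Prod>i=1..n. [:- lam i, 1:]) = (\<Prod>e\<leftarrow>map lam [1..<Suc n]. [:- e, 1:])"
proof -
  have "(\<Prod>i=1..n. [:- lam i, 1:]) = (\<Prod>i\<leftarrow>[1..<Suc n]. [:- lam i, 1:])"
    using prod.distinct_set_conv_list[OF distinct_upt, of "\<lambda>i. [:- lam i, 1:]" 1 "Suc n"]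
    by (simp only: set_upt atLeastLessThanSuc_atLeastAtMost)
  then show ?thesis by (simp add: comp_def del: upt_Suc)
qed

lemma ordered_eigenvalues_char_poly:
  assumes "ordered_eigenvalues n G lam"
  shows "char_poly (map_mat complex_of_real G) = (\<Prod>e\<leftarrow>map lam [1..<Suc n]. [:- e, 1:])"
  using assms by (simp only: ordered_eigenvalues_def prod_linear_upt)

lemma ordered_eigenvalues_le:
  assumes "ordered_eigenvalues n G lam" "2 \<le> i" "i \<le> n"
  shows "cmod (lam i) \<le> cmod (lam 2)"
  using assms(2,3)
proof (induction i rule: dec_induct)
  case (step i)
  then have "cmod (lam (Suc i)) \<le> cmod (lam i)"
    using assms(1) by (simp add: ordered_eigenvalues_def)
  then show ?case using step by simp
qed simp

lemma ordered_eigenvalues_le_1: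
  assumes "ordered_eigenvalues n G lam" "1 \<le> i" "i \<le> n"
  shows "cmod (lam i) \<le> 1"
  using assms ordered_eigenvalues_le[OF assms(1) _ assms(3)]
  by (cases "i = 1") (auto simp: ordered_eigenvalues_def)

lemma sigma_upper:
  assumes "i \<in> {2..n}" "j \<in> {1..n}"
  shows "cmod (lam i + lam j) \<le> 2 * sigma n lam"
proof -
  have "cmod (lam i + lam j) \<le> (MAX j\<in>{1..n}. cmod (lam i + lam j))"
    using assms by (intro Max_ge) auto
  also have "\<dots> \<le> (MAX i\<in>{2..n}. MAX j\<in>{1..n}. cmod (lam i + lam j))"
    using assms by (intro Max_ge) auto
  finally show ?thesis by (simp add: sigma_def)
qed

lemma sigma_nonneg: "2 \<le> n \<Longrightarrow> 0 \<le> sigma n lam"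
  using order.trans[OF norm_ge_zero sigma_upper[of 2 n 1 lam]] by simp

text \<open>In each pair the index from 2 on has modulus below 1 and the other one at most
  1.\<close>

lemma sigma_less_1:
  assumes n: "2 \<le> n" and lam: "ordered_eigenvalues n G lam"
  shows "sigma n lam < 1"
proof -
  have "cmod (lam i + lam j) < 2" if "2 \<le> i" "i \<le> n" "1 \<le> j" "j \<le> n" for i j
    using norm_triangle_ineq[of "lam i" "lam j"] ordered_eigenvalues_le[OF lam that(1,2)]
      ordered_eigenvalues_le_1[OF lam that(3,4)] lam
    unfolding ordered_eigenvalues_def by linarith
  then have "(MAX i\<in>{2..n}. MAX j\<in>{1..n}. cmod (lam i + lam j)) < 2"
    using n by (subst Max_less_iff; force)
  then show ?thesis by (simp add: sigma_def)
qed

lemma poly_prod_linear_root: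
  fixes e :: "'a::idom"
  shows "e \<in> set es \<Longrightarrow> poly (\<Prod>e\<leftarrow>es. [:- e, 1:]) e = 0"
  by (induction es) auto

context singular_quadratic
begin

lemma spectrum_G:
  assumes es: "char_poly (map_mat complex_of_real G) = (\<Prod>e\<leftarrow>es. [:- e, 1:])"
  shows "count_list es 1 = 1" and "e \<in> set es \<Longrightarrow> e \<noteq> 1 \<Longrightarrow> cmod e < 1"
proof -
  let ?G = "map_mat complex_of_real G" and ?N = "map_mat complex_of_real N"
  have Gc: "?G \<in> carrier_mat n n" and Nc: "?N \<in> carrier_mat n n"
    using G_carrier N_carrier by simp_all
  have GG: "map_mat complex_of_real (G * G) = ?G * ?G"
    by (rule of_real_hom.mat_hom_mult[OF G_carrier G_carrier])
  have "?N = 2 \<cdot>\<^sub>m ?G - ?G * ?G"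
    unfolding arg_cong[OF N_eq, of "map_mat complex_of_real"] GG[symmetric] using G_carrier
    by (intro eq_matI) (simp_all del: index_mult_mat(1))
  from char_poly_quad[OF Gc this es]
  have N: "char_poly ?N = (\<Prod>e\<leftarrow>map (\<lambda>e. 2 * e - e\<^sup>2) es. [:- e, 1:])" .
  \<comment> \<open>The value 1 has the single preimage 1, so its multiplicity is the same in both
    spectra.\<close>
  have "2 * e - e\<^sup>2 = 1 \<longleftrightarrow> e = 1" for e :: complex
  proof -
    have "2 * e - e\<^sup>2 = 1 \<longleftrightarrow> (e - 1)\<^sup>2 = 0" by (auto simp: power2_eq_square algebra_simps)
    then show ?thesis by simp
  qed
  then have "count_list (map (\<lambda>e. 2 * e - e\<^sup>2) es) 1 = count_list es 1"
    by (induction es) auto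
  then show "count_list es 1 = 1"
    using simple_eigenvalue_complex_spectrum[OF N_carrier simple N] by simp
  assume e: "e \<in> set es" "e \<noteq> 1"
  have "poly (char_poly ?G) e = 0" unfolding es by (rule poly_prod_linear_root[OF e(1)])
  then have "eigenvalue ?G e" using eigenvalue_root_char_poly[OF Gc] by simp
  from nonneg_mat_eigenvalue_le_1[OF G_carrier _ _ _ this, of "\<lambda>i. u $ i"]
  have 1: "cmod e \<le> 1" by (simp add: G_nonneg u_pos Gu_le)
  have "poly (char_poly ?N) (2 * e - e\<^sup>2) = 0"
    unfolding N using e(1) by (intro poly_prod_linear_root) auto
  then have "eigenvalue ?N (2 * e - e\<^sup>2)" using eigenvalue_root_char_poly[OF Nc] by simp
  from nonneg_mat_eigenvalue_le_1[OF N_carrier _ _ _ this, of "\<lambda>i. u $ i"]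
  have 2: "cmod (2 * e - e\<^sup>2) \<le> 1" by (simp add: N_nonneg u_pos Nu_sum)
  \<comment> \<open>The closed unit discs around 0 and around 2 touch only at 1, which the real part
    detects.\<close>
  have "e = 1" if m: "cmod e = 1"
  proof -
    have "2 * e - e\<^sup>2 = e * (2 - e)" by (simp add: power2_eq_square algebra_simps)
    then have "cmod (2 - e) \<le> 1" using 2 m by (simp add: norm_mult)
    then have "2 - Re e \<le> 1" using complex_Re_le_cmod[of "2 - e"] by simp
    then have "Re e \<ge> 1" by simp
    moreover have "(Re e)\<^sup>2 + (Im e)\<^sup>2 = 1" using m cmod_power2[of e] by simp
    ultimately have "(Im e)\<^sup>2 \<le> 0" using one_le_power[of "Re e" 2] by linarith
    then have "Im e = 0" by simp
    then show ?thesis using m \<open>Re e \<ge> 1\<close> by (simp add: complex_eq_iff cmod_def)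
  qed
  then show "cmod e < 1" using 1 e(2) by force
qed

lemma ordered_eigenvalues_exist: "\<exists>lam. ordered_eigenvalues n G lam"
proof -
  have Gc: "map_mat complex_of_real G \<in> carrier_mat n n" using G_carrier by simp
  obtain as where as: "char_poly (map_mat complex_of_real G) = (\<Prod>e\<leftarrow>as. [:- e, 1:])" "length as = n"
    using char_poly_factorized[OF Gc] by auto
  \<comment> \<open>Negating the key sorts by decreasing modulus.\<close>
  define es where "es = sort_key (\<lambda>e. - cmod e) as"
  have "mset es = mset as" by (simp add: es_def)
  then have "prod_mset (image_mset (\<lambda>e. [:- e, 1:]) (mset es)) = prod_mset (image_mset (\<lambda>e. [:- e, 1:]) (mset as))"
    by simp
  then have es: "char_poly (map_mat complex_of_real G) = (\<Prod>e\<leftarrow>es. [:- e, 1:])"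
    unfolding as by (simp only: mset_map[symmetric] prod_mset_prod_list)
  have len: "length es = n" using as(2) by (simp add: es_def)
  have sorted: "cmod (es ! j) \<le> cmod (es ! i)" if "i \<le> j" "j < n" for i j
    using sorted_nth_mono[OF sorted_sort_key[of "\<lambda>e. - cmod e" as], folded es_def, of i j] that len by simp
  note sp = spectrum_G[OF es]
  have "1 \<in> set es" using sp(1) by (metis count_notin zero_neq_one)
  then obtain p where p: "p < n" "es ! p = 1" using len by (auto simp: in_set_conv_nth)
  \<comment> \<open>The head has modulus at least that of the occurring eigenvalue 1, and every
    other eigenvalue lies strictly inside the unit disc.\<close>
  have h: "es ! 0 = 1"
    using sp(2)[of "es ! 0"] sorted[of 0 p] p len by (force simp: in_set_conv_nth)
  obtain e0 e1 rest where split: "es = e0 # e1 # rest"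
    using len n by (cases es; cases "tl es") auto
  have "e1 \<noteq> 1" using sp(1) h unfolding split by auto
  then have e1: "cmod e1 < 1" using sp(2) unfolding split by simp
  define lam where "lam i = es ! (i - 1)" for i
  have "map lam [1..<Suc n] = es"
    using len by (intro nth_equalityI) (simp_all add: lam_def del: upt_Suc)
  then have "char_poly (map_mat complex_of_real G) = (\<Prod>i=1..n. [:- lam i, 1:])"
    unfolding es prod_linear_upt by simp
  moreover have "cmod (lam (Suc i)) \<le> cmod (lam i)" if "i \<in> {2..<n}" for i
    using sorted[of "i - 1" i] that by (simp add: lam_def)
  ultimately have "ordered_eigenvalues n G lam"
    using h e1 by (auto simp: ordered_eigenvalues_def lam_def split)
  then show ?thesis by blast
qed

section \<open>The two rates, with \<open>u\<close> alone and with \<open>u\<close> and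
  \<open>v\<close> fixed\<close>

lemma rate:
  assumes X: "\<And>k. X k \<in> carrier_mat n n" and X_Suc: "\<And>k. X (Suc k) = step (X k)"
    and lim: "mat_tendsto n X G" and X0u: "X 0 *\<^sub>v u = u" and lam: "ordered_eigenvalues n G lam"
  shows "root_rate_le n X G (sigma n lam)"
    and "pos_vec n v \<Longrightarrow> transpose_mat N *\<^sub>v v = v \<Longrightarrow> transpose_mat (X 0) *\<^sub>v v = v \<Longrightarrow>
      root_rate_le n X G (cmod (lam 2))"
proof -
  let ?H = "map_mat complex_of_real G"
  have Hc: "?H \<in> carrier_mat n n" using G_carrier by simp
  define D where "D k = map_mat complex_of_real (X k - G)" for k
  have Dc: "D k \<in> carrier_mat n n" for k using minus_carrier_mat[OF G_carrier] by (simp add: D_def)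
  have n0: "0 < n" using n by simp
  have lam1: "lam 1 = 1" using lam by (simp add: ordered_eigenvalues_def)
  have Xu: "X k *\<^sub>v u = u" for k
    by (induction k) (simp_all add: X0u X_Suc step_def quad_step_fixed_vec[OF X N_carrier u_carrier _ Nu])
  obtain T P Q where s: "T \<in> carrier_mat n n" "P \<in> carrier_mat n n" "Q \<in> carrier_mat n n"
    "P * Q = 1\<^sub>m n" "Q * P = 1\<^sub>m n" "?H = P * T * Q" "upper_triangular T"
    and T: "\<And>i. i < n \<Longrightarrow> T $$ (i, i) = map lam [1..<Suc n] ! i"
    using schur_triangularization[OF Hc ordered_eigenvalues_char_poly[OF lam]] by metis
  \<comment> \<open>Matrix indices start at 0 and eigenvalue indices at 1, so the eigenvalue
    \<open>lam 1 = 1\<close> stands at position 0.\<close>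
  have T': "T $$ (i, i) = lam (Suc i)" if "i < n" for i
    using T[OF that] that by (simp del: upt_Suc)
  have "?H *\<^sub>v col P 0 = col P 0"
    using schur_first_column[OF s(1-3,5-7) n0] T'[OF n0] lam1 by simp
  then have col0: "D k *\<^sub>v col P 0 = 0\<^sub>v n" for k
    unfolding D_def using s(2) col_carrier_vec[OF n0 s(2)]
    by (intro fixed_vec_in_error_kernel[OF G_carrier N_eq simple u_carrier Nu u_nonzero X Xu]) simp_all
  show "root_rate_le n X G (sigma n lam)"
  proof (rule root_rate_le_of_triangularizations[OF G_carrier N_eq X X_Suc[unfolded step_def] lim
        s(1-3) s(1-3) s(4,5) s(4,5) s(6) s(6) s(7) s(7) sigma_nonneg[OF n]], fold D_def)
    fix k i j assume ij: "i < n" "j < n"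
    show "(Q * D k * P) $$ (i, j) = 0 \<or> cmod (T $$ (j, j) + T $$ (i, i)) \<le> 2 * sigma n lam"
    proof (cases "j = 0")
      case True
      then show ?thesis using error_conj_entry_zero(1)[OF s(3) Dc s(2) ij] col0 by simp
    next
      \<comment> \<open>The column index gives the eigenvalue index \<open>Suc j \<ge> 2\<close>,
        the restricted one in \<open>sigma\<close>; the row index is unrestricted because nothing is
        known here about left vectors.\<close>
      case False
      then have "cmod (lam (Suc j) + lam (Suc i)) \<le> 2 * sigma n lam"
        using ij by (intro sigma_upper) auto
      then show ?thesis using T' ij by simp
    qed
  qed
  assume v: "pos_vec n v" "transpose_mat N *\<^sub>v v = v" "transpose_mat (X 0) *\<^sub>v v = v"
  have vc: "v \<in> carrier_vec n" and v0: "v \<noteq> 0\<^sub>v n"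
    using v(1) n0 by (auto simp: pos_vec_def)
  have NT: "transpose_mat N \<in> carrier_mat n n" and GT: "transpose_mat G \<in> carrier_mat n n"
    and XT: "transpose_mat (X k) \<in> carrier_mat n n" for k
    using N_carrier G_carrier X by simp_all
  have Xv: "transpose_mat (X k) *\<^sub>v v = v" for k
  proof (induction k)
    case (Suc k)
    then show ?case
      unfolding X_Suc step_def transpose_quad_step[OF X N_carrier]
      by (rule quad_step_fixed_vec[OF XT NT vc _ v(2)])
  qed (rule v(3))
  \<comment> \<open>The second ordering rotates the eigenvalue 1 to the end, so that the last row of
    \<open>Q2\<close> is a left eigenvector for it.\<close>
  define es where "es = map lam [2..<Suc n] @ [1]"
  have "[1..<Suc n] = 1 # [2..<Suc n]" using n by (simp add: upt_conv_Cons numeral_2_eq_2 del: upt_Suc)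
  then have "char_poly ?H = (\<Prod>e\<leftarrow>es. [:- e, 1:])"
    using ordered_eigenvalues_char_poly[OF lam] lam1 unfolding es_def
    by (simp del: mult_pCons_left mult_pCons_right upt_Suc add: mult.commute)
  then obtain T2 P2 Q2 where s2: "T2 \<in> carrier_mat n n" "P2 \<in> carrier_mat n n" "Q2 \<in> carrier_mat n n"
    "P2 * Q2 = 1\<^sub>m n" "Q2 * P2 = 1\<^sub>m n" "?H = P2 * T2 * Q2" "upper_triangular T2"
    and T2: "\<And>i. i < n \<Longrightarrow> T2 $$ (i, i) = es ! i"
    using schur_triangularization[OF Hc] by metis
  define p where "p = n - 1"
  have p: "Suc p = n" "p < n" using n0 by (simp_all add: p_def)
  have T2p: "T2 $$ (p, p) = 1"
    using T2[OF p(2)] p by (simp add: es_def nth_append p_def del: upt_Suc)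
  have T2': "T2 $$ (i, i) = lam (i + 2)" if "i < p" for i
    using T2[of i] that by (simp add: es_def nth_append p_def del: upt_Suc)
  have "transpose_mat ?H *\<^sub>v row Q2 p = row Q2 p"
    using schur_last_row[OF s2(1-3,5-7) p(1)] T2p by simp
  then have "map_mat complex_of_real (transpose_mat G) *\<^sub>v row Q2 p = row Q2 p"
    using map_mat_transpose[of complex_of_real G] by simp
  then have "map_mat complex_of_real (transpose_mat (X k) - transpose_mat G) *\<^sub>v row Q2 p = 0\<^sub>v n" for k
    using row_carrier_vec[OF p(2) s2(3)]
    by (intro fixed_vec_in_error_kernel[OF GT quad_transpose[OF G_carrier N_eq]
        simple_eigenvalue_transpose[OF N_carrier simple] vc v(2) v0 XT Xv]) simp_all
  moreover have "map_mat complex_of_real (transpose_mat (X k) - transpose_mat G) = transpose_mat (D k)" for k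
    unfolding D_def using X[of k] G_carrier by (intro eq_matI) simp_all
  ultimately have rowp: "transpose_mat (D k) *\<^sub>v row Q2 p = 0\<^sub>v n" for k by simp
  show "root_rate_le n X G (cmod (lam 2))"
  proof (rule root_rate_le_of_triangularizations[OF G_carrier N_eq X X_Suc[unfolded step_def] lim
        s(1-3) s2(1-3) s(4,5) s2(4,5) s(6) s2(6) s(7) s2(7) norm_ge_zero], fold D_def)
    fix k i j assume ij: "i < n" "j < n"
    \<comment> \<open>Column 0 vanishes because of \<open>u\<close> and row \<open>p\<close> because
      of \<open>v\<close>. Everywhere else both diagonal entries are among \<open>lam 2\<close>,
      ..., \<open>lam n\<close>.\<close>
    consider "j = 0" | "i = p" | "0 < j" "i < p" using ij p by linarith
    then show "(Q2 * D k * P) $$ (i, j) = 0 \<or> cmod (T $$ (j, j) + T2 $$ (i, i)) \<le> 2 * cmod (lam 2)"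
    proof cases
      case 1
      then show ?thesis using error_conj_entry_zero(1)[OF s2(3) Dc s(2) ij] col0 by simp
    next
      case 2
      then show ?thesis using error_conj_entry_zero(2)[OF s2(3) Dc s(2) ij] rowp by simp
    next
      case 3
      have "cmod (lam (Suc j)) \<le> cmod (lam 2)" "cmod (lam (i + 2)) \<le> cmod (lam 2)"
        using ij 3 p by (auto intro!: ordered_eigenvalues_le[OF lam])
      then have "cmod (lam (Suc j) + lam (i + 2)) \<le> 2 * cmod (lam 2)"
        using norm_triangle_ineq[of "lam (Suc j)" "lam (i + 2)"] by linarith
      then show ?thesis using T'[OF ij(2)] T2'[OF 3(2)] by simp
    qed
  qed
qed

end

theorem theorem2:
  fixes n :: nat and A N :: "real mat" and u :: "real vec" and X :: "nat \<Rightarrow> real mat"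
  assumes n: "n \<ge> 2"
    and N: "nonneg_mat n N"
    and A: "A = 1\<^sub>m n - N"
    and M: "M_matrix n A"
    and singular: "det A = 0"
    and u: "pos_vec n u"
    and Nu: "N *\<^sub>v u = u"
    and simple: "simple_eigenvalue N 1"
    and X0: "nonneg_mat n (X 0)"
    and X0u: "X 0 *\<^sub>v u \<le> u"
    and X_Suc: "\<And>k. X (Suc k) = (1/2) \<cdot>\<^sub>m (X k ^\<^sub>m 2 + N)"
  shows "\<exists>G. minimal_nonneg_solution n N G \<and> mat_tendsto n X G \<and>
           (\<exists>lam. ordered_eigenvalues n G lam) \<and>
           (\<forall>lam. ordered_eigenvalues n G lam \<longrightarrow>
              sigma n lam < 1 \<and>
              (X 0 *\<^sub>v u = u \<longrightarrow> root_rate_le n X G (sigma n lam)) \<and>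
              (\<forall>v. X 0 *\<^sub>v u = u \<longrightarrow> pos_vec n v \<longrightarrow>
                   transpose_mat N *\<^sub>v v = v \<longrightarrow> transpose_mat (X 0) *\<^sub>v v = v \<longrightarrow>
                   root_rate_le n X G (cmod (lam 2))))"
proof -
  interpret singular_quadratic n N u
    using n N u Nu simple by unfold_locales
  have X0c: "X 0 \<in> carrier_mat n n" using X0 by (simp add: nonneg_mat_iff)
  have step: "X (Suc k) = step (X k)" for k by (simp add: X_Suc step_def)
  have Xc: "X k \<in> carrier_mat n n" for k
    by (induction k) (simp_all add: X0c step step_carrier)
  have "(\<Sum>j<n. X 0 $$ (i, j) * u $ j) \<le> u $ i" if "i < n" for i
    unfolding mult_mat_vec_sum[OF X0c u_carrier that, symmetric]
    using X0u that u_carrier by (simp add: less_eq_vec_def del: index_mult_mat_vec)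
  then have "substochastic n u (X 0)" using X0 by (simp add: substochastic_def nonneg_mat_iff)
  then have lim: "mat_tendsto n X G" using step by (rule convergence)
  show ?thesis
    using minimal_G lim ordered_eigenvalues_exist sigma_less_1[OF n] rate[OF Xc step lim] by blast
qed

end
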